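(* Let $(M,\Delta_\diamond,\Delta_\bullet,\alpha_M)$ be a comodule over the post-Hom-Lie coalgebra $(L,\gamma,\Delta_\cdot,\alpha)$. Let $\beta:L\to L$ be an endomorphism of the post-Hom-Lie coalgebra $L$ and let $\beta_M:M\to M$ be a linear map such that $\alpha_M\circ\beta_M=\beta_M\circ\alpha_M$, $\Delta_\diamond\circ\beta_M=(\beta\otimes\beta_M)\circ\Delta_\diamond$ and $\Delta_\bullet\circ\beta_M=(\beta\otimes\beta_M)\circ\Delta_\bullet$. Define $$\tilde\Delta_\diamond=(\beta\otimes \mathrm{Id}_M)\circ\Delta_\diamond\circ\beta_M:M\to L\otimes M,\qquad \tilde\Delta_\bullet=(\beta\otimes \mathrm{Id}_M)\circ\Delta_\bullet\circ\beta_M:M\to L\otimes M .$$ Then $(M,\tilde\Delta_\diamond,\tilde\Delta_\bullet,\alpha_M\circ\beta_M)$ is a comodule over the post-Hom-Lie coalgebra $(L,\gamma\circ\beta,\Delta_\cdot\circ\beta,\beta\circ\alpha)$.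
   Context: All vector spaces are over a field $\mathbb{F}$ of characteristic $0$; $I$ is the identity map, $\tau(x\otimes y)=y\otimes x$, $\xi(x\otimes y\otimes z)=y\otimes z\otimes x$, $\xi^2(x\otimes y\otimes z)=z\otimes x\otimes y$. A post-Hom-Lie coalgebra $(L,\gamma,\Delta_\cdot,\alpha)$ is a vector space $L$ with linear maps $\gamma,\Delta_\cdot:L\to L\otimes L$ and $\alpha:L\to L$ such that (i) $\gamma=-\tau\circ\gamma$ and $\gamma\circ\alpha=(\alpha\otimes\alpha)\circ\gamma$; (ii) $(1+\xi+\xi^2)\circ(\alpha\otimes\gamma)\circ\gamma=0$; (iii) $(\alpha\otimes\gamma)\circ\Delta_\cdot-(\Delta_\cdot\otimes\alpha)\circ\gamma-(\tau\otimes I)\circ(\alpha\otimes\Delta_\cdot)\circ\gamma=0$; (iv) $(\Delta_\cdot\otimes\alpha)\circ\Delta_\cdot-(\alpha\otimes\Delta_\cdot)\circ\Delta_\cdot-(\tau\otimes I)\circ(\Delta_\cdot\otimes\alpha)\circ\Delta_\cdot+(\tau\otimes I)\circ(\alpha\otimes\Delta_\cdot)\circ\Delta_\cdot+(\gamma\otimes\alpha)\circ\Delta_\cdot=0$. An endomorphism of it is a linear map $\beta:L\to L$ with $\Delta_\cdot\circ\beta=(\beta\otimes\beta)\circ\Delta_\cdot$, $\gamma\circ\beta=(\beta\otimes\beta)\circ\gamma$ and $\alpha\circ\beta=\beta\circ\alpha$. A comodule over $(L,\gamma,\Delta_\cdot,\alpha)$ is a tuple $(M,\Delta_\diamond,\Delta_\bullet,\alpha_M)$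 with $M$ a vector space, $\alpha_M:M\to M$ linear, and linear maps $\Delta_\diamond,\Delta_\bullet:M\to L\otimes M$ such that (a) $\Delta_\diamond\circ\alpha_M=(\alpha\otimes\alpha_M)\circ\Delta_\diamond$ and $\Delta_\bullet\circ\alpha_M=(\alpha\otimes\alpha_M)\circ\Delta_\bullet$; (b) $(\gamma\otimes\alpha_M)\circ\Delta_\diamond=(\alpha\otimes\Delta_\diamond)\circ\Delta_\diamond-(\tau\otimes \mathrm{Id}_M)\circ(\alpha\otimes\Delta_\diamond)\circ\Delta_\diamond$; (c) $(\Delta_\cdot\otimes\alpha_M)\circ\Delta_\diamond=(\alpha\otimes\Delta_\diamond)\circ\Delta_\bullet-(\tau\otimes \mathrm{Id}_M)\circ(\alpha\otimes\Delta_\bullet)\circ\Delta_\diamond$; (d) $(\gamma\otimes\alpha_M)\circ\Delta_\bullet=(1-\tau\otimes \mathrm{Id}_M)\circ(\alpha\otimes\Delta_\bullet)\circ\Delta_\bullet+(\tau\otimes \mathrm{Id}_M-1)\circ(\Delta_\cdot\otimes\alpha_M)\circ\Delta_\bullet$. *)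

theory Defs
  imports "HOL-Algebra.QuotRing" "Jordan_Normal_Form.Missing_VectorSpace"
begin

locale field_of_char_0 = field K for K (structure) +
  assumes char_0: "(n::nat) > 0 \<Longrightarrow> [n] \<cdot> \<one> \<noteq> \<zero>"

section \<open>Free vector spaces, quotients and tensor products\<close>

text \<open>
  The ring multiplication and unit, which the record \<^type>\<open>module_ext\<close> inherits from rings, play no
  role for a vector space and are left undefined.
\<close>

definition free_vs :: "('k, 'r) ring_scheme \<Rightarrow> 'a set \<Rightarrow> ('k, 'a \<Rightarrow> 'k) module" where
  "free_vs K S =
     \<lparr>carrier = {f. (\<forall>p. f p \<in> carrier K) \<and> finite {p. f p \<noteq> \<zero>\<^bsub>K\<^esub>} \<and> {p. f p \<noteq> \<zero>\<^bsub>K\<^esub>} \<subseteq> S},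
      mult = undefined, one = undefined,
      zero = (\<lambda>p. \<zero>\<^bsub>K\<^esub>),
      add = (\<lambda>f g p. f p \<oplus>\<^bsub>K\<^esub> g p),
      smult = (\<lambda>c f p. c \<otimes>\<^bsub>K\<^esub> f p)\<rparr>"

definition free_gen :: "('k, 'r) ring_scheme \<Rightarrow> 'a \<Rightarrow> 'a \<Rightarrow> 'k" where
  "free_gen K p = (\<lambda>q. if q = p then \<one>\<^bsub>K\<^esub> else \<zero>\<^bsub>K\<^esub>)"

text \<open>
  The scalar multiple of a coset is the coset generated by the multiples of its representatives
  (for \<open>c = \<zero>\<close> these multiples alone would not fill a coset), as in \<^const>\<open>FactRing\<close>.
\<close>

definition quotient_vs :: "('k, 'v, 's) module_scheme \<Rightarrow> 'v set \<Rightarrow> ('k, 'v set) module" where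
  "quotient_vs V N =
     \<lparr>carrier = a_rcosets\<^bsub>V\<^esub> N,
      mult = undefined, one = undefined,
      zero = N,
      add = set_add V,
      smult = (\<lambda>c X. \<Union>v\<in>X. N +>\<^bsub>V\<^esub> (c \<odot>\<^bsub>V\<^esub> v))\<rparr>"

definition bilinear_relators ::
  "('k, 'r) ring_scheme \<Rightarrow> ('k, 'v, 's) module_scheme \<Rightarrow> ('k, 'w, 't) module_scheme \<Rightarrow>
     ('v \<times> 'w \<Rightarrow> 'k) set" where
  "bilinear_relators K V W =
     (let F = free_vs K (carrier V \<times> carrier W); e = (\<lambda>x y. free_gen K (x, y)) in
       {e (x \<oplus>\<^bsub>V\<^esub> x') y \<ominus>\<^bsub>F\<^esub> (e x y \<oplus>\<^bsub>F\<^esub> e x' y) | x x' y.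
          x \<in> carrier V \<and> x' \<in> carrier V \<and> y \<in> carrier W}
     \<union> {e x (y \<oplus>\<^bsub>W\<^esub> y') \<ominus>\<^bsub>F\<^esub> (e x y \<oplus>\<^bsub>F\<^esub> e x y') | x y y'.
          x \<in> carrier V \<and> y \<in> carrier W \<and> y' \<in> carrier W}
     \<union> {e (c \<odot>\<^bsub>V\<^esub> x) y \<ominus>\<^bsub>F\<^esub> c \<odot>\<^bsub>F\<^esub> e x y | c x y.
          c \<in> carrier K \<and> x \<in> carrier V \<and> y \<in> carrier W}
     \<union> {e x (c \<odot>\<^bsub>W\<^esub> y) \<ominus>\<^bsub>F\<^esub> c \<odot>\<^bsub>F\<^esub> e x y | c x y.
          c \<in> carrier K \<and> x \<in> carrier V \<and> y \<in> carrier W})"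

definition tensor_kernel ::
  "('k, 'r) ring_scheme \<Rightarrow> ('k, 'v, 's) module_scheme \<Rightarrow> ('k, 'w, 't) module_scheme \<Rightarrow>
     ('v \<times> 'w \<Rightarrow> 'k) set" where
  "tensor_kernel K V W =
     LinearCombinations.module.span K (free_vs K (carrier V \<times> carrier W)) (bilinear_relators K V W)"

definition tensor ::
  "('k, 'r) ring_scheme \<Rightarrow> ('k, 'v, 's) module_scheme \<Rightarrow> ('k, 'w, 't) module_scheme \<Rightarrow>
     ('k, ('v \<times> 'w \<Rightarrow> 'k) set) module" where
  "tensor K V W = quotient_vs (free_vs K (carrier V \<times> carrier W)) (tensor_kernel K V W)"

definition pure_tensor ::
  "('k, 'r) ring_scheme \<Rightarrow> ('k, 'v, 's) module_scheme \<Rightarrow> ('k, 'w, 't) module_scheme \<Rightarrow>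
     'v \<Rightarrow> 'w \<Rightarrow> ('v \<times> 'w \<Rightarrow> 'k) set" where
  "pure_tensor K V W x y =
     tensor_kernel K V W +>\<^bsub>free_vs K (carrier V \<times> carrier W)\<^esub> free_gen K (x, y)"

text \<open>
  For a bilinear map \<open>b\<close> on \<open>V \<times> W\<close> with values in \<open>U\<close>, \<open>tensor_lift K U b\<close> is the linear map on
  \<open>V \<otimes> W\<close> that it induces: the linear extension of \<open>b\<close> to the free vector space is constant on
  every coset of the kernel.
\<close>

definition free_lift ::
  "('k, 'r) ring_scheme \<Rightarrow> ('k, 'u, 's) module_scheme \<Rightarrow> ('a \<Rightarrow> 'u) \<Rightarrow> ('a \<Rightarrow> 'k) \<Rightarrow> 'u" where
  "free_lift K U h f = (\<Oplus>\<^bsub>U\<^esub>p\<in>{p. f p \<noteq> \<zero>\<^bsub>K\<^esub>}. f p \<odot>\<^bsub>U\<^esub> h p)"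

definition tensor_lift ::
  "('k, 'r) ring_scheme \<Rightarrow> ('k, 'u, 's) module_scheme \<Rightarrow> ('v \<Rightarrow> 'w \<Rightarrow> 'u) \<Rightarrow>
     ('v \<times> 'w \<Rightarrow> 'k) set \<Rightarrow> 'u" where
  "tensor_lift K U b X = the_elem (free_lift K U (\<lambda>(x, y). b x y) ` X)"

text \<open>\<open>tensor_map K V W f g\<close> is \<open>f \<otimes> g\<close>; here \<open>V\<close> and \<open>W\<close> are the codomains of \<open>f\<close> and \<open>g\<close>.\<close>

definition tensor_map ::
  "('k, 'r) ring_scheme \<Rightarrow> ('k, 'v, 's) module_scheme \<Rightarrow> ('k, 'w, 't) module_scheme \<Rightarrow>
     ('a \<Rightarrow> 'v) \<Rightarrow> ('b \<Rightarrow> 'w) \<Rightarrow> ('a \<times> 'b \<Rightarrow> 'k) set \<Rightarrow> ('v \<times> 'w \<Rightarrow> 'k) set" where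
  "tensor_map K V W f g = tensor_lift K (tensor K V W) (\<lambda>x y. pure_tensor K V W (f x) (g y))"

text \<open>\<open>tensor_swap K V W : V \<otimes> W \<rightarrow> W \<otimes> V\<close>, \<open>x \<otimes> y \<mapsto> y \<otimes> x\<close>\<close>

definition tensor_swap ::
  "('k, 'r) ring_scheme \<Rightarrow> ('k, 'v, 's) module_scheme \<Rightarrow> ('k, 'w, 't) module_scheme \<Rightarrow>
     ('v \<times> 'w \<Rightarrow> 'k) set \<Rightarrow> ('w \<times> 'v \<Rightarrow> 'k) set" where
  "tensor_swap K V W = tensor_lift K (tensor K W V) (\<lambda>x y. pure_tensor K W V y x)"

text \<open>
  The iterated tensor product \<open>U \<otimes> V \<otimes> W\<close> is represented by \<open>(U \<otimes> V) \<otimes> W\<close>. The canonical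
  isomorphism \<open>U \<otimes> (V \<otimes> W) \<rightarrow> (U \<otimes> V) \<otimes> W\<close>, \<open>x \<otimes> (y \<otimes> z) \<mapsto> (x \<otimes> y) \<otimes> z\<close>, which is usually left
  implicit, is \<open>tensor_assoc K U V W\<close>.
\<close>

definition tensor3 ::
  "('k, 'r) ring_scheme \<Rightarrow> ('k, 'u, 'q) module_scheme \<Rightarrow> ('k, 'v, 's) module_scheme \<Rightarrow>
     ('k, 'w, 't) module_scheme \<Rightarrow> ('k, (('u \<times> 'v \<Rightarrow> 'k) set \<times> 'w \<Rightarrow> 'k) set) module" where
  "tensor3 K U V W = tensor K (tensor K U V) W"

definition pure_tensor3 ::
  "('k, 'r) ring_scheme \<Rightarrow> ('k, 'u, 'q) module_scheme \<Rightarrow> ('k, 'v, 's) module_scheme \<Rightarrow>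
     ('k, 'w, 't) module_scheme \<Rightarrow> 'u \<Rightarrow> 'v \<Rightarrow> 'w \<Rightarrow> (('u \<times> 'v \<Rightarrow> 'k) set \<times> 'w \<Rightarrow> 'k) set" where
  "pure_tensor3 K U V W x y z = pure_tensor K (tensor K U V) W (pure_tensor K U V x y) z"

definition tensor_assoc ::
  "('k, 'r) ring_scheme \<Rightarrow> ('k, 'u, 'q) module_scheme \<Rightarrow> ('k, 'v, 's) module_scheme \<Rightarrow>
     ('k, 'w, 't) module_scheme \<Rightarrow>
     ('u \<times> ('v \<times> 'w \<Rightarrow> 'k) set \<Rightarrow> 'k) set \<Rightarrow> (('u \<times> 'v \<Rightarrow> 'k) set \<times> 'w \<Rightarrow> 'k) set" where
  "tensor_assoc K U V W =
     tensor_lift K (tensor3 K U V W)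
       (\<lambda>x. tensor_lift K (tensor3 K U V W) (\<lambda>y z. pure_tensor3 K U V W x y z))"

text \<open>\<open>\<xi> : V \<otimes> V \<otimes> V \<rightarrow> V \<otimes> V \<otimes> V\<close>, \<open>x \<otimes> y \<otimes> z \<mapsto> y \<otimes> z \<otimes> x\<close>\<close>

definition tensor_cycle ::
  "('k, 'r) ring_scheme \<Rightarrow> ('k, 'v, 's) module_scheme \<Rightarrow>
     (('v \<times> 'v \<Rightarrow> 'k) set \<times> 'v \<Rightarrow> 'k) set \<Rightarrow> (('v \<times> 'v \<Rightarrow> 'k) set \<times> 'v \<Rightarrow> 'k) set" where
  "tensor_cycle K V =
     tensor_lift K (tensor3 K V V V)
       (\<lambda>w z. tensor_lift K (tensor3 K V V V) (\<lambda>x y. pure_tensor3 K V V V y z x) w)"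

section \<open>Post-Hom-Lie coalgebras and their comodules\<close>

text \<open>
  Maps are only relevant on the carriers, so an equality of maps is stated pointwise on the carrier.
\<close>

locale post_Hom_Lie_coalgebra = field_of_char_0 K
  for K :: "('k, 'r) ring_scheme" (structure)
    and L :: "('k, 'l, 's) module_scheme"
    and \<gamma> :: "'l \<Rightarrow> ('l \<times> 'l \<Rightarrow> 'k) set"
    and \<Delta> :: "'l \<Rightarrow> ('l \<times> 'l \<Rightarrow> 'k) set"
    and \<alpha> :: "'l \<Rightarrow> 'l" +
  assumes linear_gamma: "linear_map K L (tensor K L L) \<gamma>"
    and linear_Delta: "linear_map K L (tensor K L L) \<Delta>"
    and linear_alpha: "linear_map K L L \<alpha>"
    and gamma_antisym:
      "x \<in> carrier L \<Longrightarrow> \<gamma> x = \<ominus>\<^bsub>tensor K L L\<^esub> tensor_swap K L L (\<gamma> x)"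
    and gamma_alpha:
      "x \<in> carrier L \<Longrightarrow> \<gamma> (\<alpha> x) = tensor_map K L L \<alpha> \<alpha> (\<gamma> x)"
    and Hom_Jacobi:
      "\<lbrakk>x \<in> carrier L;
        w = tensor_assoc K L L L (tensor_map K L (tensor K L L) \<alpha> \<gamma> (\<gamma> x))\<rbrakk> \<Longrightarrow>
       w \<oplus>\<^bsub>tensor3 K L L L\<^esub> tensor_cycle K L w
         \<oplus>\<^bsub>tensor3 K L L L\<^esub> tensor_cycle K L (tensor_cycle K L w) = \<zero>\<^bsub>tensor3 K L L L\<^esub>"
    and Delta_gamma:
      "x \<in> carrier L \<Longrightarrow>
       tensor_assoc K L L L (tensor_map K L (tensor K L L) \<alpha> \<gamma> (\<Delta> x))
         \<ominus>\<^bsub>tensor3 K L L L\<^esub> tensor_map K (tensor K L L) L \<Delta> \<alpha> (\<gamma> x)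
         \<ominus>\<^bsub>tensor3 K L L L\<^esub> tensor_map K (tensor K L L) L (tensor_swap K L L) id
             (tensor_assoc K L L L (tensor_map K L (tensor K L L) \<alpha> \<Delta> (\<gamma> x)))
       = \<zero>\<^bsub>tensor3 K L L L\<^esub>"
    and Delta_coassociator:
      "x \<in> carrier L \<Longrightarrow>
       tensor_map K (tensor K L L) L \<Delta> \<alpha> (\<Delta> x)
         \<ominus>\<^bsub>tensor3 K L L L\<^esub> tensor_assoc K L L L (tensor_map K L (tensor K L L) \<alpha> \<Delta> (\<Delta> x))
         \<ominus>\<^bsub>tensor3 K L L L\<^esub> tensor_map K (tensor K L L) L (tensor_swap K L L) id
             (tensor_map K (tensor K L L) L \<Delta> \<alpha> (\<Delta> x))
         \<oplus>\<^bsub>tensor3 K L L L\<^esub> tensor_map K (tensor K L L) L (tensor_swap K L L) id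
             (tensor_assoc K L L L (tensor_map K L (tensor K L L) \<alpha> \<Delta> (\<Delta> x)))
         \<oplus>\<^bsub>tensor3 K L L L\<^esub> tensor_map K (tensor K L L) L \<gamma> \<alpha> (\<Delta> x)
       = \<zero>\<^bsub>tensor3 K L L L\<^esub>"

locale post_Hom_Lie_coalgebra_endomorphism = post_Hom_Lie_coalgebra K L \<gamma> \<Delta> \<alpha>
  for K :: "('k, 'r) ring_scheme" (structure)
    and L :: "('k, 'l, 's) module_scheme"
    and \<gamma> \<Delta> \<alpha>
    and \<beta> :: "'l \<Rightarrow> 'l" +
  assumes linear_beta: "linear_map K L L \<beta>"
    and Delta_beta: "x \<in> carrier L \<Longrightarrow> \<Delta> (\<beta> x) = tensor_map K L L \<beta> \<beta> (\<Delta> x)"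
    and gamma_beta: "x \<in> carrier L \<Longrightarrow> \<gamma> (\<beta> x) = tensor_map K L L \<beta> \<beta> (\<gamma> x)"
    and alpha_beta: "x \<in> carrier L \<Longrightarrow> \<alpha> (\<beta> x) = \<beta> (\<alpha> x)"

text \<open>\<open>D\<close> and \<open>B\<close> stand for \<open>\<Delta>\<^sub>\<diamond>\<close> and \<open>\<Delta>\<^sub>\<bullet>\<close>, and \<open>\<mu>\<close> for \<open>\<alpha>\<^sub>M\<close>.\<close>

locale post_Hom_Lie_comodule = post_Hom_Lie_coalgebra K L \<gamma> \<Delta> \<alpha>
  for K :: "('k, 'r) ring_scheme" (structure)
    and L :: "('k, 'l, 's) module_scheme"
    and \<gamma> \<Delta> \<alpha>
    and M :: "('k, 'm, 't) module_scheme"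
    and D :: "'m \<Rightarrow> ('l \<times> 'm \<Rightarrow> 'k) set"
    and B :: "'m \<Rightarrow> ('l \<times> 'm \<Rightarrow> 'k) set"
    and \<mu> :: "'m \<Rightarrow> 'm" +
  assumes linear_D: "linear_map K M (tensor K L M) D"
    and linear_B: "linear_map K M (tensor K L M) B"
    and linear_mu: "linear_map K M M \<mu>"
    and D_mu: "m \<in> carrier M \<Longrightarrow> D (\<mu> m) = tensor_map K L M \<alpha> \<mu> (D m)"
    and B_mu: "m \<in> carrier M \<Longrightarrow> B (\<mu> m) = tensor_map K L M \<alpha> \<mu> (B m)"
    and gamma_D:
      "m \<in> carrier M \<Longrightarrow>
       tensor_map K (tensor K L L) M \<gamma> \<mu> (D m) =
         tensor_assoc K L L M (tensor_map K L (tensor K L M) \<alpha> D (D m))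
         \<ominus>\<^bsub>tensor3 K L L M\<^esub> tensor_map K (tensor K L L) M (tensor_swap K L L) id
             (tensor_assoc K L L M (tensor_map K L (tensor K L M) \<alpha> D (D m)))"
    and Delta_D:
      "m \<in> carrier M \<Longrightarrow>
       tensor_map K (tensor K L L) M \<Delta> \<mu> (D m) =
         tensor_assoc K L L M (tensor_map K L (tensor K L M) \<alpha> D (B m))
         \<ominus>\<^bsub>tensor3 K L L M\<^esub> tensor_map K (tensor K L L) M (tensor_swap K L L) id
             (tensor_assoc K L L M (tensor_map K L (tensor K L M) \<alpha> B (D m)))"
    and gamma_B:
      "\<lbrakk>m \<in> carrier M;
        v = tensor_assoc K L L M (tensor_map K L (tensor K L M) \<alpha> B (B m));
        w = tensor_map K (tensor K L L) M \<Delta> \<mu> (B m)\<rbrakk> \<Longrightarrow>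
       tensor_map K (tensor K L L) M \<gamma> \<mu> (B m) =
         (v \<ominus>\<^bsub>tensor3 K L L M\<^esub> tensor_map K (tensor K L L) M (tensor_swap K L L) id v)
         \<oplus>\<^bsub>tensor3 K L L M\<^esub>
         (tensor_map K (tensor K L L) M (tensor_swap K L L) id w \<ominus>\<^bsub>tensor3 K L L M\<^esub> w)"

section \<open>The universal property\<close>

text \<open>
  The facts below confirm that \<^const>\<open>tensor\<close> satisfies the universal property of the tensor product
  (\<open>tensor_lift_universal\<close> for existence, \<open>tensor_ext\<close> for uniqueness) and that the structure maps
  take the expected values on pure tensors.
\<close>

lemma free_vs_simps:
  "carrier (free_vs K S) = {f. (\<forall>p. f p \<in> carrier K) \<and> finite {p. f p \<noteq> \<zero>\<^bsub>K\<^esub>} \<and> {p. f p \<noteq> \<zero>\<^bsub>K\<^esub>} \<subseteq> S}"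
  "\<zero>\<^bsub>free_vs K S\<^esub> = (\<lambda>p. \<zero>\<^bsub>K\<^esub>)"
  "f \<oplus>\<^bsub>free_vs K S\<^esub> g = (\<lambda>p. f p \<oplus>\<^bsub>K\<^esub> g p)"
  "c \<odot>\<^bsub>free_vs K S\<^esub> f = (\<lambda>p. c \<otimes>\<^bsub>K\<^esub> f p)"
  by (simp_all add: free_vs_def)

lemma free_vs_vectorspace:
  assumes "field K" shows "vectorspace K (free_vs K S)"
proof -
  interpret field K by fact
  show ?thesis
  proof (rule vs_criteria)
    show "field K" by fact
    show "\<zero>\<^bsub>free_vs K S\<^esub> \<in> carrier (free_vs K S)" by (simp add: free_vs_simps)
    show "\<forall>v w. v \<in> carrier (free_vs K S) \<and> w \<in> carrier (free_vs K S) \<longrightarrow>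
          v \<oplus>\<^bsub>free_vs K S\<^esub> w \<in> carrier (free_vs K S)"
    proof (intro allI impI)
      fix v w assume a: "v \<in> carrier (free_vs K S) \<and> w \<in> carrier (free_vs K S)"
      have "{p. v p \<oplus>\<^bsub>K\<^esub> w p \<noteq> \<zero>\<^bsub>K\<^esub>} \<subseteq> {p. v p \<noteq> \<zero>\<^bsub>K\<^esub>} \<union> {p. w p \<noteq> \<zero>\<^bsub>K\<^esub>}" using a
        by (auto simp: free_vs_simps)
      then show "v \<oplus>\<^bsub>free_vs K S\<^esub> w \<in> carrier (free_vs K S)"
        using a by (auto simp: free_vs_simps intro: finite_subset)
    qed
    show "\<forall>v\<in>carrier (free_vs K S). \<exists>n\<in>carrier (free_vs K S). v \<oplus>\<^bsub>free_vs K S\<^esub> n = \<zero>\<^bsub>free_vs K S\<^esub>"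
    proof
      fix v assume a: "v \<in> carrier (free_vs K S)"
      have "{p. \<ominus>\<^bsub>K\<^esub> v p \<noteq> \<zero>\<^bsub>K\<^esub>} \<subseteq> {p. v p \<noteq> \<zero>\<^bsub>K\<^esub>}" using a by auto
      then show "\<exists>n\<in>carrier (free_vs K S). v \<oplus>\<^bsub>free_vs K S\<^esub> n = \<zero>\<^bsub>free_vs K S\<^esub>"
        using a by (intro bexI[of _ "\<lambda>p. \<ominus>\<^bsub>K\<^esub> v p"]) (auto simp: free_vs_simps r_neg intro: finite_subset)
    qed
    show "\<forall>c v. c \<in> carrier K \<and> v \<in> carrier (free_vs K S) \<longrightarrow> c \<odot>\<^bsub>free_vs K S\<^esub> v \<in> carrier (free_vs K S)"
    proof (intro allI impI)
      fix c v assume a: "c \<in> carrier K \<and> v \<in> carrier (free_vs K S)"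
      have "{p. c \<otimes>\<^bsub>K\<^esub> v p \<noteq> \<zero>\<^bsub>K\<^esub>} \<subseteq> {p. v p \<noteq> \<zero>\<^bsub>K\<^esub>}" using a by auto
      then show "c \<odot>\<^bsub>free_vs K S\<^esub> v \<in> carrier (free_vs K S)"
        using a by (auto simp: free_vs_simps intro: finite_subset)
    qed
  qed (auto simp: free_vs_simps a_ac m_assoc l_distr r_distr fun_eq_iff)
qed

context vectorspace
begin

lemma submodule_abelian_subgroup:
  assumes "LinearCombinations.submodule K N V"
  shows "abelian_subgroup N V"
proof -
  interpret N: LinearCombinations.submodule K N V by fact
  have inv: "\<ominus>\<^bsub>V\<^esub> v \<in> N" if "v \<in> N" for v
  proof -
    have "(\<ominus>\<^bsub>K\<^esub> \<one>\<^bsub>K\<^esub>) \<odot>\<^bsub>V\<^esub> v \<in> N" using that by simp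
    moreover have "v \<in> carrier V" using that N.subset by auto
    ultimately show ?thesis by (simp add: smult_l_minus)
  qed
  show ?thesis
    apply (rule abelian_subgroupI3)
     apply (rule additive_subgroup.intro)
     apply (rule add.subgroupI)
    subgoal using N.subset by auto
    subgoal using N.zero_closed by blast
    subgoal using inv by (auto simp: a_inv_def[symmetric])
    subgoal using N.m_closed by auto
    by (rule abelian_group_axioms)
qed

lemma quotient_vs_vectorspace:
  assumes N: "LinearCombinations.submodule K N V"
  shows "vectorspace K (quotient_vs V N)"
   and "linear_map K V (quotient_vs V N) (\<lambda>v. N +>\<^bsub>V\<^esub> v)"
proof -
  interpret N: LinearCombinations.submodule K N V by fact
  interpret A: abelian_subgroup N V by (rule submodule_abelian_subgroup[OF N])
  have c: "carrier (quotient_vs V N) = (\<lambda>v. N +>\<^bsub>V\<^esub> v) ` carrier V"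
    by (auto simp: quotient_vs_def A_RCOSETS_def')
  have z: "\<zero>\<^bsub>quotient_vs V N\<^esub> = N +>\<^bsub>V\<^esub> \<zero>\<^bsub>V\<^esub>" by (simp add: quotient_vs_def A.a_rcos_const)
  have a: "(N +>\<^bsub>V\<^esub> v) \<oplus>\<^bsub>quotient_vs V N\<^esub> (N +>\<^bsub>V\<^esub> w) = N +>\<^bsub>V\<^esub> (v \<oplus>\<^bsub>V\<^esub> w)"
    if "v \<in> carrier V" "w \<in> carrier V" for v w
    using that by (simp add: quotient_vs_def A.a_rcos_sum)
  have s: "k \<odot>\<^bsub>quotient_vs V N\<^esub> (N +>\<^bsub>V\<^esub> v) = N +>\<^bsub>V\<^esub> (k \<odot>\<^bsub>V\<^esub> v)"
    if "v \<in> carrier V" "k \<in> carrier K" for v k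
  proof -
    have "N +>\<^bsub>V\<^esub> (k \<odot>\<^bsub>V\<^esub> w) = N +>\<^bsub>V\<^esub> (k \<odot>\<^bsub>V\<^esub> v)" if w: "w \<in> N +>\<^bsub>V\<^esub> v" for w
    proof -
      obtain n where n: "n \<in> N" "w = n \<oplus>\<^bsub>V\<^esub> v" using w by (auto simp: a_r_coset_def')
      have nc: "n \<in> carrier V" using n N.subset by auto
      have "k \<odot>\<^bsub>V\<^esub> w = k \<odot>\<^bsub>V\<^esub> n \<oplus>\<^bsub>V\<^esub> k \<odot>\<^bsub>V\<^esub> v" using n nc \<open>v \<in> carrier V\<close> \<open>k \<in> carrier K\<close>
        by (simp add: smult_r_distr)
      moreover have "k \<odot>\<^bsub>V\<^esub> n \<in> N" using n \<open>k \<in> carrier K\<close> by simp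
      ultimately have "k \<odot>\<^bsub>V\<^esub> w \<in> N +>\<^bsub>V\<^esub> (k \<odot>\<^bsub>V\<^esub> v)" by (auto simp: a_r_coset_def')
      then show ?thesis using A.a_repr_independence'[of "k \<odot>\<^bsub>V\<^esub> w" "k \<odot>\<^bsub>V\<^esub> v"] \<open>v \<in> carrier V\<close> \<open>k \<in> carrier K\<close>
        by simp
    qed
    moreover have "v \<in> N +>\<^bsub>V\<^esub> v" using that by (simp add: A.a_rcos_self)
    ultimately have "(\<Union>w\<in>N +>\<^bsub>V\<^esub> v. N +>\<^bsub>V\<^esub> (k \<odot>\<^bsub>V\<^esub> w)) = N +>\<^bsub>V\<^esub> (k \<odot>\<^bsub>V\<^esub> v)"
      by blast
    then show ?thesis by (simp add: quotient_vs_def)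
  qed
  show vs: "vectorspace K (quotient_vs V N)"
    apply (rule vs_criteria)
    subgoal by (rule field.field_axioms)
    subgoal by (auto simp: c z)
    subgoal by (auto simp: c a)
    subgoal
    proof
      fix X assume "X \<in> carrier (quotient_vs V N)"
      then obtain v where v: "v \<in> carrier V" "X = N +>\<^bsub>V\<^esub> v" by (auto simp: c)
      show "\<exists>Y\<in>carrier (quotient_vs V N). X \<oplus>\<^bsub>quotient_vs V N\<^esub> Y = \<zero>\<^bsub>quotient_vs V N\<^esub>"
        using v by (intro bexI[of _ "N +>\<^bsub>V\<^esub> (\<ominus>\<^bsub>V\<^esub> v)"]) (auto simp: c z a M.r_neg)
    qed
    subgoal by (auto simp: c s)
    subgoal by (auto simp: c a M.a_comm)
    subgoal by (auto simp: c a M.a_assoc)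
    subgoal by (auto simp: c a z)
    subgoal by (auto simp: c s smult_assoc1)
    subgoal by (auto simp: c s)
    subgoal by (auto simp: c s a smult_l_distr)
    subgoal by (auto simp: c s a smult_r_distr)
    done
  show "linear_map K V (quotient_vs V N) (\<lambda>v. N +>\<^bsub>V\<^esub> v)"
    unfolding linear_map_def mod_hom_def mod_hom_axioms_def
    using vs vectorspace_axioms by (auto simp: vectorspace_def module_hom_def c a s)
qed

end


lemma free_gen_carrier: "field K \<Longrightarrow> p \<in> S \<Longrightarrow> free_gen K p \<in> carrier (free_vs K S)"
proof -
  assume "field K" and p: "p \<in> S"
  interpret field K by fact
  have "{q. free_gen K p q \<noteq> \<zero>\<^bsub>K\<^esub>} \<subseteq> {p}" by (auto simp: free_gen_def)
  then show ?thesis using p by (auto simp: free_vs_simps free_gen_def intro: finite_subset)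
qed

lemma free_lift_linear:
  assumes U: "vectorspace K U" and h: "h \<in> S \<rightarrow> carrier U"
  shows "linear_map K (free_vs K S) U (free_lift K U h)"
   and "p \<in> S \<Longrightarrow> free_lift K U h (free_gen K p) = h p"
proof -
  interpret U: vectorspace K U by fact
  interpret F: vectorspace K "free_vs K S" by (rule free_vs_vectorspace) unfold_locales
  have ext: "free_lift K U h f = (\<Oplus>\<^bsub>U\<^esub>p\<in>A. f p \<odot>\<^bsub>U\<^esub> h p)"
    if "f \<in> carrier (free_vs K S)" "finite A" "A \<subseteq> S" "{p. f p \<noteq> \<zero>\<^bsub>K\<^esub>} \<subseteq> A" for f A
    unfolding free_lift_def using that h
    by (intro U.add.finprod_mono_neutral_cong_left) (auto simp: free_vs_simps Pi_iff subset_iff)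
  show "linear_map K (free_vs K S) U (free_lift K U h)"
    unfolding linear_map_def mod_hom_def mod_hom_axioms_def
  proof (intro conjI)
    show "free_lift K U h \<in> module_hom K (free_vs K S) U"
      unfolding module_hom_def
    proof (intro CollectI conjI allI impI)
      show "free_lift K U h \<in> carrier (free_vs K S) \<rightarrow> carrier U"
        using h by (auto simp: free_lift_def free_vs_simps Pi_iff subset_iff intro!: U.finsum_closed)
      fix f g assume fg: "f \<in> carrier (free_vs K S) \<and> g \<in> carrier (free_vs K S)"
      let ?A = "{p. f p \<noteq> \<zero>\<^bsub>K\<^esub>} \<union> {p. g p \<noteq> \<zero>\<^bsub>K\<^esub>}"
      have A: "finite ?A" "?A \<subseteq> S" using fg by (auto simp: free_vs_simps)
      have s: "f \<oplus>\<^bsub>free_vs K S\<^esub> g \<in> carrier (free_vs K S)" using fg by simp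
      have "{p. (f \<oplus>\<^bsub>free_vs K S\<^esub> g) p \<noteq> \<zero>\<^bsub>K\<^esub>} \<subseteq> ?A" using fg by (auto simp: free_vs_simps)
      then have "free_lift K U h (f \<oplus>\<^bsub>free_vs K S\<^esub> g) = (\<Oplus>\<^bsub>U\<^esub>p\<in>?A. (f \<oplus>\<^bsub>free_vs K S\<^esub> g) p \<odot>\<^bsub>U\<^esub> h p)"
        by (rule ext[OF s A])
      also have "\<dots> = (\<Oplus>\<^bsub>U\<^esub>p\<in>?A. f p \<odot>\<^bsub>U\<^esub> h p \<oplus>\<^bsub>U\<^esub> g p \<odot>\<^bsub>U\<^esub> h p)"
        using fg h A by (intro U.finsum_cong') (auto simp: free_vs_simps Pi_iff U.smult_l_distr subset_iff)
      also have "\<dots> = free_lift K U h f \<oplus>\<^bsub>U\<^esub> free_lift K U h g"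
        using fg h A ext[of f ?A] ext[of g ?A]
        by (subst U.finsum_addf) (auto simp: free_vs_simps Pi_iff subset_iff)
      finally show "free_lift K U h (f \<oplus>\<^bsub>free_vs K S\<^esub> g) = free_lift K U h f \<oplus>\<^bsub>U\<^esub> free_lift K U h g" .
    next
      fix c f assume cf: "c \<in> carrier K \<and> f \<in> carrier (free_vs K S)"
      let ?A = "{p. f p \<noteq> \<zero>\<^bsub>K\<^esub>}"
      have A: "finite ?A" "?A \<subseteq> S" using cf by (auto simp: free_vs_simps)
      have s: "c \<odot>\<^bsub>free_vs K S\<^esub> f \<in> carrier (free_vs K S)" using cf by simp
      have "{p. (c \<odot>\<^bsub>free_vs K S\<^esub> f) p \<noteq> \<zero>\<^bsub>K\<^esub>} \<subseteq> ?A" using cf by (auto simp: free_vs_simps)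
      then have "free_lift K U h (c \<odot>\<^bsub>free_vs K S\<^esub> f) = (\<Oplus>\<^bsub>U\<^esub>p\<in>?A. (c \<odot>\<^bsub>free_vs K S\<^esub> f) p \<odot>\<^bsub>U\<^esub> h p)"
        by (rule ext[OF s A])
      also have "\<dots> = (\<Oplus>\<^bsub>U\<^esub>p\<in>?A. c \<odot>\<^bsub>U\<^esub> (f p \<odot>\<^bsub>U\<^esub> h p))"
        using cf h A by (intro U.finsum_cong') (auto simp: free_vs_simps Pi_iff U.smult_assoc1 subset_iff)
      also have "\<dots> = c \<odot>\<^bsub>U\<^esub> free_lift K U h f"
        unfolding free_lift_def using cf h A
        by (subst U.finsum_smult) (auto simp: free_vs_simps Pi_iff subset_iff)
      finally show "free_lift K U h (c \<odot>\<^bsub>free_vs K S\<^esub> f) = c \<odot>\<^bsub>U\<^esub> free_lift K U h f" .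
    qed
  qed unfold_locales
  show "free_lift K U h (free_gen K p) = h p" if p: "p \<in> S"
  proof -
    have "field K" by unfold_locales
    from ext[OF free_gen_carrier[OF this p], of "{p}"] p h show ?thesis
      by (auto simp: free_gen_def Pi_iff)
  qed
qed

lemma bilinear_relators_carrier:
  assumes V: "vectorspace K V" and W: "vectorspace K W"
  shows "bilinear_relators K V W \<subseteq> carrier (free_vs K (carrier V \<times> carrier W))"
proof -
  interpret V: vectorspace K V by fact
  interpret W: vectorspace K W by fact
  have f: "field K" by unfold_locales
  interpret F: vectorspace K "free_vs K (carrier V \<times> carrier W)" by (rule free_vs_vectorspace[OF f])
  show ?thesis unfolding bilinear_relators_def Let_def
    by (auto intro!: F.minus_closed F.add.m_closed F.smult_closed free_gen_carrier[OF f])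
qed

lemma tensor_kernel_submodule:
  assumes V: "vectorspace K V" and W: "vectorspace K W"
  shows "LinearCombinations.submodule K (tensor_kernel K V W) (free_vs K (carrier V \<times> carrier W))"
proof -
  interpret V: vectorspace K V by fact
  have f: "field K" by unfold_locales
  interpret F: vectorspace K "free_vs K (carrier V \<times> carrier W)" by (rule free_vs_vectorspace[OF f])
  show ?thesis unfolding tensor_kernel_def by (rule F.span_is_submodule) (rule bilinear_relators_carrier[OF V W])
qed

definition bilinear_map ::
  "('k, 'r) ring_scheme \<Rightarrow> ('k, 'v, 's) module_scheme \<Rightarrow> ('k, 'w, 't) module_scheme \<Rightarrow>
     ('k, 'u, 'q) module_scheme \<Rightarrow> ('v \<Rightarrow> 'w \<Rightarrow> 'u) \<Rightarrow> bool" where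
  "bilinear_map K V W U b \<longleftrightarrow>
  (\<forall>x\<in>carrier V. linear_map K W U (b x)) \<and> (\<forall>y\<in>carrier W. linear_map K V U (\<lambda>x. b x y))"

lemma tensor_vectorspace: assumes V: "vectorspace K V" and W: "vectorspace K W"
  shows "vectorspace K (tensor K V W)"
proof -
  interpret V: vectorspace K V by fact
  have f: "field K" by unfold_locales
  show ?thesis unfolding tensor_def
    by (rule vectorspace.quotient_vs_vectorspace[OF free_vs_vectorspace[OF f] tensor_kernel_submodule[OF V W]])
qed

lemma tensor_lift_universal:
  assumes V: "vectorspace K V" and W: "vectorspace K W" and U: "vectorspace K U" and b: "bilinear_map K V W U b"
  shows "linear_map K (tensor K V W) U (tensor_lift K U b)"
   and "x \<in> carrier V \<Longrightarrow> y \<in> carrier W \<Longrightarrow> tensor_lift K U b (pure_tensor K V W x y) = b x y"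
proof -
  interpret V: vectorspace K V by fact
  interpret W: vectorspace K W by fact
  interpret U: vectorspace K U by fact
  have f: "field K" by unfold_locales
  let ?S = "carrier V \<times> carrier W"
  let ?F = "free_vs K ?S" and ?N = "tensor_kernel K V W" and ?h = "\<lambda>(x, y). b x y"
  interpret F: vectorspace K ?F by (rule free_vs_vectorspace[OF f])
  have bl: "\<And>x. x\<in>carrier V \<Longrightarrow> linear_map K W U (b x)" "\<And>y. y\<in>carrier W \<Longrightarrow> linear_map K V U (\<lambda>x. b x y)"
    using b by (auto simp: bilinear_map_def)
  have h: "?h \<in> ?S \<rightarrow> carrier U"
    using bl(1) by (fastforce simp: linear_map_def mod_hom_def mod_hom_axioms_def module_hom_def)
  interpret g: linear_map K ?F U "free_lift K U ?h" by (rule free_lift_linear(1)[OF U h])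
  note gp = free_lift_linear(2)[OF U h]
  have fc: "free_gen K (x, y) \<in> carrier ?F" if "x \<in> carrier V" "y \<in> carrier W" for x y
    using that by (intro free_gen_carrier[OF f]) auto
  have ker: "bilinear_relators K V W \<subseteq> g.ker"
  proof -
    have *: "u \<ominus>\<^bsub>?F\<^esub> v \<in> g.ker" if "u \<in> carrier ?F" "v \<in> carrier ?F" "free_lift K U ?h u = free_lift K U ?h v" for u v
      using that by (simp add: g.ker_def g.f_minus a_minus_def U.r_neg del: g.f0_is_0)
    have add1: "\<And>x x' y. \<lbrakk>x \<in> carrier V; x' \<in> carrier V; y \<in> carrier W\<rbrakk> \<Longrightarrow> b (x \<oplus>\<^bsub>V\<^esub> x') y = b x y \<oplus>\<^bsub>U\<^esub> b x' y"
     and add2: "\<And>x y y'. \<lbrakk>x \<in> carrier V; y \<in> carrier W; y' \<in> carrier W\<rbrakk> \<Longrightarrow> b x (y \<oplus>\<^bsub>W\<^esub> y') = b x y \<oplus>\<^bsub>U\<^esub> b x y'"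
     and sm1: "\<And>c x y. \<lbrakk>c \<in> carrier K; x \<in> carrier V; y \<in> carrier W\<rbrakk> \<Longrightarrow> b (c \<odot>\<^bsub>V\<^esub> x) y = c \<odot>\<^bsub>U\<^esub> b x y"
     and sm2: "\<And>c x y. \<lbrakk>c \<in> carrier K; x \<in> carrier V; y \<in> carrier W\<rbrakk> \<Longrightarrow> b x (c \<odot>\<^bsub>W\<^esub> y) = c \<odot>\<^bsub>U\<^esub> b x y"
      using bl by (auto simp: linear_map_def mod_hom_def mod_hom_axioms_def module_hom_def)
    show ?thesis unfolding bilinear_relators_def Let_def
      by (auto intro!: * simp: fc gp add1 add2 sm1 sm2)
  qed
  have Nk: "?N \<subseteq> g.ker" unfolding tensor_kernel_def
    by (rule F.span_is_subset[OF ker g.ker_is_submodule])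
  interpret N: LinearCombinations.submodule K ?N ?F by (rule tensor_kernel_submodule[OF V W])
  interpret A: abelian_subgroup ?N ?F by (rule F.submodule_abelian_subgroup) unfold_locales
  have val: "tensor_lift K U b (?N +>\<^bsub>?F\<^esub> v) = free_lift K U ?h v" if v: "v \<in> carrier ?F" for v
  proof -
    have "free_lift K U ?h w = free_lift K U ?h v" if w: "w \<in> ?N +>\<^bsub>?F\<^esub> v" for w
    proof -
      obtain n where n: "n \<in> ?N" "w = n \<oplus>\<^bsub>?F\<^esub> v" using w by (auto simp: a_r_coset_def')
      then have "n \<in> carrier ?F" "free_lift K U ?h n = \<zero>\<^bsub>U\<^esub>" using Nk by (auto simp: g.ker_def)
      then show ?thesis using n v by simp
    qed
    moreover have "v \<in> ?N +>\<^bsub>?F\<^esub> v" using v by (simp add: A.a_rcos_self)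
    ultimately have "free_lift K U ?h ` (?N +>\<^bsub>?F\<^esub> v) = {free_lift K U ?h v}" by blast
    then show ?thesis by (simp add: tensor_lift_def)
  qed
  show "tensor_lift K U b (pure_tensor K V W x y) = b x y" if "x \<in> carrier V" "y \<in> carrier W"
    using that by (simp add: pure_tensor_def val fc gp)
  have q: "linear_map K ?F (tensor K V W) (\<lambda>v. ?N +>\<^bsub>?F\<^esub> v)"
    unfolding tensor_def by (rule F.quotient_vs_vectorspace) unfold_locales
  then interpret q: linear_map K ?F "tensor K V W" "\<lambda>v. ?N +>\<^bsub>?F\<^esub> v" .
  have c: "\<exists>v\<in>carrier ?F. X = ?N +>\<^bsub>?F\<^esub> v" if "X \<in> carrier (tensor K V W)" for X
    using that by (auto simp: tensor_def quotient_vs_def A_RCOSETS_def')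
  show "linear_map K (tensor K V W) U (tensor_lift K U b)"
    unfolding linear_map_def mod_hom_def mod_hom_axioms_def
  proof (intro conjI)
    show "tensor_lift K U b \<in> module_hom K (tensor K V W) U"
      unfolding module_hom_def
      by (auto dest!: c simp: val q.f_add[symmetric] q.f_smult[symmetric] simp del: q.f_add q.f_smult)
  qed unfold_locales
qed


lemma linear_mapI:
  assumes "vectorspace K V" "vectorspace K U"
   "\<And>x. x \<in> carrier V \<Longrightarrow> f x \<in> carrier U"
   "\<And>x y. x \<in> carrier V \<Longrightarrow> y \<in> carrier V \<Longrightarrow> f (x \<oplus>\<^bsub>V\<^esub> y) = f x \<oplus>\<^bsub>U\<^esub> f y"
   "\<And>c x. c \<in> carrier K \<Longrightarrow> x \<in> carrier V \<Longrightarrow> f (c \<odot>\<^bsub>V\<^esub> x) = c \<odot>\<^bsub>U\<^esub> f x"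
  shows "linear_map K V U f"
  using assms by (auto simp: linear_map_def mod_hom_def mod_hom_axioms_def module_hom_def vectorspace_def)

lemma pure_tensor_bilinear:
  assumes V: "vectorspace K V" and W: "vectorspace K W"
  shows "bilinear_map K V W (tensor K V W) (pure_tensor K V W)"
proof -
  interpret V: vectorspace K V by fact
  interpret W: vectorspace K W by fact
  have f: "field K" by unfold_locales
  let ?S = "carrier V \<times> carrier W"
  let ?F = "free_vs K ?S" and ?N = "tensor_kernel K V W"
  interpret F: vectorspace K ?F by (rule free_vs_vectorspace[OF f])
  interpret T: vectorspace K "tensor K V W" by (rule tensor_vectorspace[OF V W])
  interpret N: LinearCombinations.submodule K ?N ?F by (rule tensor_kernel_submodule[OF V W])
  interpret A: abelian_subgroup ?N ?F by (rule F.submodule_abelian_subgroup) unfold_locales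
  have q: "linear_map K ?F (tensor K V W) (\<lambda>v. ?N +>\<^bsub>?F\<^esub> v)"
    unfolding tensor_def by (rule F.quotient_vs_vectorspace) unfold_locales
  then interpret q: linear_map K ?F "tensor K V W" "\<lambda>v. ?N +>\<^bsub>?F\<^esub> v" .
  have fc: "free_gen K (x, y) \<in> carrier ?F" if "x \<in> carrier V" "y \<in> carrier W" for x y
    using that by (intro free_gen_carrier[OF f]) auto
  have R: "bilinear_relators K V W \<subseteq> ?N" unfolding tensor_kernel_def
    by (rule F.in_own_span[OF bilinear_relators_carrier[OF V W]])
  have *: "?N +>\<^bsub>?F\<^esub> u = ?N +>\<^bsub>?F\<^esub> v" if "u \<ominus>\<^bsub>?F\<^esub> v \<in> bilinear_relators K V W" "u \<in> carrier ?F" "v \<in> carrier ?F" for u v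
  proof -
    have "u = (u \<ominus>\<^bsub>?F\<^esub> v) \<oplus>\<^bsub>?F\<^esub> v" using that by (simp add: a_minus_def F.a_assoc F.l_neg)
    then have "u \<in> ?N +>\<^bsub>?F\<^esub> v" using that R by (auto simp: a_r_coset_def')
    then show ?thesis using A.a_repr_independence' that by auto
  qed
  have mem:
    "x \<in> carrier V \<Longrightarrow> x' \<in> carrier V \<Longrightarrow> y \<in> carrier W \<Longrightarrow>
      free_gen K (x \<oplus>\<^bsub>V\<^esub> x', y) \<ominus>\<^bsub>?F\<^esub> (free_gen K (x, y) \<oplus>\<^bsub>?F\<^esub> free_gen K (x', y)) \<in> bilinear_relators K V W"
    "x \<in> carrier V \<Longrightarrow> y \<in> carrier W \<Longrightarrow> y' \<in> carrier W \<Longrightarrow>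
      free_gen K (x, y \<oplus>\<^bsub>W\<^esub> y') \<ominus>\<^bsub>?F\<^esub> (free_gen K (x, y) \<oplus>\<^bsub>?F\<^esub> free_gen K (x, y')) \<in> bilinear_relators K V W"
    "c \<in> carrier K \<Longrightarrow> x \<in> carrier V \<Longrightarrow> y \<in> carrier W \<Longrightarrow>
      free_gen K (c \<odot>\<^bsub>V\<^esub> x, y) \<ominus>\<^bsub>?F\<^esub> c \<odot>\<^bsub>?F\<^esub> free_gen K (x, y) \<in> bilinear_relators K V W"
    "c \<in> carrier K \<Longrightarrow> x \<in> carrier V \<Longrightarrow> y \<in> carrier W \<Longrightarrow>
      free_gen K (x, c \<odot>\<^bsub>W\<^esub> y) \<ominus>\<^bsub>?F\<^esub> c \<odot>\<^bsub>?F\<^esub> free_gen K (x, y) \<in> bilinear_relators K V W"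
    for c x x' y y'
    unfolding bilinear_relators_def Let_def by blast+
  note eqs = mem[THEN *]
  have T: "vectorspace K (tensor K V W)" by (rule tensor_vectorspace[OF V W])
  have "linear_map K W (tensor K V W) (\<lambda>y. ?N +>\<^bsub>?F\<^esub> free_gen K (x, y))" if "x \<in> carrier V" for x
    by (rule linear_mapI[OF W T]) (use that in \<open>simp_all add: fc eqs\<close>)
  moreover have "linear_map K V (tensor K V W) (\<lambda>x. ?N +>\<^bsub>?F\<^esub> free_gen K (x, y))" if "y \<in> carrier W" for y
    by (rule linear_mapI[OF V T]) (use that in \<open>simp_all add: fc eqs\<close>)
  ultimately show ?thesis by (auto simp: bilinear_map_def pure_tensor_def[abs_def])
qed

lemma free_vs_span:
  assumes f: "field K" and v: "v \<in> carrier (free_vs K S)"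
  shows "v \<in> LinearCombinations.module.span K (free_vs K S) (free_gen K ` S)"
proof -
  interpret F: vectorspace K "free_vs K S" by (rule free_vs_vectorspace[OF f])
  have gc: "free_gen K ` S \<subseteq> carrier (free_vs K S)" using free_gen_carrier[OF f] by auto
  interpret s: LinearCombinations.submodule K "F.span (free_gen K ` S)" "free_vs K S"
    by (rule F.span_is_submodule[OF gc])
  have "w \<in> F.span (free_gen K ` S)" if "finite A" "w \<in> carrier (free_vs K S)" "{p. w p \<noteq> \<zero>\<^bsub>K\<^esub>} = A" for A w
    using that
  proof (induction A arbitrary: w rule: finite_induct)
    case empty
    then have "w = \<zero>\<^bsub>free_vs K S\<^esub>" by (auto simp: free_vs_simps)
    then show ?case using s.zero_closed by simp
  next
    case (insert a A)
    define w' where "w' = w(a := \<zero>\<^bsub>K\<^esub>)"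
    have "{p. w' p \<noteq> \<zero>\<^bsub>K\<^esub>} = A" using insert by (auto simp: w'_def)
    moreover have "w' \<in> carrier (free_vs K S)" using insert calculation by (auto simp: free_vs_simps w'_def)
    ultimately have 1: "w' \<in> F.span (free_gen K ` S)" by (rule insert.IH[rotated])
    have aS: "a \<in> S" "w a \<in> carrier K" using insert by (auto simp: free_vs_simps)
    then have 2: "w a \<odot>\<^bsub>free_vs K S\<^esub> free_gen K a \<in> F.span (free_gen K ` S)"
      using F.in_own_span[OF gc] by (intro s.smult_closed) auto
    have "w = w' \<oplus>\<^bsub>free_vs K S\<^esub> w a \<odot>\<^bsub>free_vs K S\<^esub> free_gen K a"
      using insert.prems aS by (auto simp: free_vs_simps w'_def free_gen_def fun_eq_iff)
    then show ?case using s.m_closed[OF 1 2] by simp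
  qed
  then show ?thesis using v by (auto simp: free_vs_simps)
qed

lemma tensor_ext:
  assumes V: "vectorspace K V" and W: "vectorspace K W"
   and f: "linear_map K (tensor K V W) U f" and g: "linear_map K (tensor K V W) U g"
   and eq: "\<And>x y. x \<in> carrier V \<Longrightarrow> y \<in> carrier W \<Longrightarrow> f (pure_tensor K V W x y) = g (pure_tensor K V W x y)"
   and t: "t \<in> carrier (tensor K V W)"
  shows "f t = g t"
proof -
  interpret V: vectorspace K V by fact
  interpret f: linear_map K "tensor K V W" U f by fact
  interpret g: linear_map K "tensor K V W" U g by fact
  have fl: "field K" by unfold_locales
  let ?S = "carrier V \<times> carrier W"
  let ?F = "free_vs K ?S" and ?N = "tensor_kernel K V W"
  interpret F: vectorspace K ?F by (rule free_vs_vectorspace[OF fl])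
  interpret N: LinearCombinations.submodule K ?N ?F by (rule tensor_kernel_submodule[OF V W])
  have q: "linear_map K ?F (tensor K V W) (\<lambda>v. ?N +>\<^bsub>?F\<^esub> v)"
    unfolding tensor_def by (rule F.quotient_vs_vectorspace) unfold_locales
  then interpret q: linear_map K ?F "tensor K V W" "\<lambda>v. ?N +>\<^bsub>?F\<^esub> v" .
  let ?E = "{v \<in> carrier ?F. f (?N +>\<^bsub>?F\<^esub> v) = g (?N +>\<^bsub>?F\<^esub> v)}"
  have E: "LinearCombinations.submodule K ?E ?F"
    by (rule LinearCombinations.submodule.intro) (unfold_locales, auto)
  have "free_gen K ` ?S \<subseteq> ?E"
    using eq by (auto simp: pure_tensor_def intro!: free_gen_carrier[OF fl])
  then have "F.span (free_gen K ` ?S) \<subseteq> ?E" by (rule F.span_is_subset[OF _ E])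
  moreover obtain v where "v \<in> carrier ?F" "t = ?N +>\<^bsub>?F\<^esub> v"
    using t by (auto simp: tensor_def quotient_vs_def A_RCOSETS_def')
  ultimately show ?thesis using free_vs_span[OF fl] by auto
qed

lemma linear_mapD: "linear_map K V W f \<Longrightarrow> x \<in> carrier V \<Longrightarrow> f x \<in> carrier W"
   "linear_map K V W f \<Longrightarrow> vectorspace K V" "linear_map K V W f \<Longrightarrow> vectorspace K W"
  by (auto simp: linear_map_def mod_hom_def mod_hom_axioms_def module_hom_def)

lemma linear_map_comp:
  assumes f: "linear_map K V W f" and g: "linear_map K W U g"
  shows "linear_map K V U (\<lambda>x. g (f x))"
proof -
  interpret f: linear_map K V W f by fact
  interpret g: linear_map K W U g by fact
  show ?thesis by (rule linear_mapI[OF linear_mapD(2)[OF f] linear_mapD(3)[OF g]]) auto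
qed

lemma pure_tensor_linear: assumes "vectorspace K V" "vectorspace K W"
  shows "x \<in> carrier V \<Longrightarrow> linear_map K W (tensor K V W) (pure_tensor K V W x)"
   "y \<in> carrier W \<Longrightarrow> linear_map K V (tensor K V W) (\<lambda>x. pure_tensor K V W x y)"
  using pure_tensor_bilinear[OF assms] by (auto simp: bilinear_map_def)

lemma tensor_map_pure:
  assumes f: "linear_map K A V f" and g: "linear_map K B W g"
  shows "linear_map K (tensor K A B) (tensor K V W) (tensor_map K V W f g)"
   and "x \<in> carrier A \<Longrightarrow> y \<in> carrier B \<Longrightarrow> tensor_map K V W f g (pure_tensor K A B x y) = pure_tensor K V W (f x) (g y)"
proof -
  have b: "bilinear_map K A B (tensor K V W) (\<lambda>x y. pure_tensor K V W (f x) (g y))"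
    unfolding bilinear_map_def using linear_mapD[OF f] linear_mapD[OF g]
    by (auto intro!: linear_map_comp[OF g pure_tensor_linear(1)] linear_map_comp[OF f pure_tensor_linear(2)])
  note l = tensor_lift_universal[OF linear_mapD(2)[OF f] linear_mapD(2)[OF g] tensor_vectorspace[OF linear_mapD(3)[OF f] linear_mapD(3)[OF g]] b]
  show "linear_map K (tensor K A B) (tensor K V W) (tensor_map K V W f g)"
   and "x \<in> carrier A \<Longrightarrow> y \<in> carrier B \<Longrightarrow> tensor_map K V W f g (pure_tensor K A B x y) = pure_tensor K V W (f x) (g y)"
    using l by (auto simp: tensor_map_def)
qed

lemma tensor_swap_pure:
  assumes V: "vectorspace K V" and W: "vectorspace K W"
  shows "linear_map K (tensor K V W) (tensor K W V) (tensor_swap K V W)"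
   and "x \<in> carrier V \<Longrightarrow> y \<in> carrier W \<Longrightarrow> tensor_swap K V W (pure_tensor K V W x y) = pure_tensor K W V y x"
proof -
  have b: "bilinear_map K V W (tensor K W V) (\<lambda>x y. pure_tensor K W V y x)"
    using pure_tensor_linear[OF W V] by (auto simp: bilinear_map_def)
  note l = tensor_lift_universal[OF V W tensor_vectorspace[OF W V] b]
  show "linear_map K (tensor K V W) (tensor K W V) (tensor_swap K V W)"
   and "x \<in> carrier V \<Longrightarrow> y \<in> carrier W \<Longrightarrow> tensor_swap K V W (pure_tensor K V W x y) = pure_tensor K W V y x"
    using l by (auto simp: tensor_swap_def)
qed

lemma tensor_lift_linear_param:
  fixes K V W U
  assumes V: "vectorspace K V" and W: "vectorspace K W" and U: "vectorspace K U"
   and Q: "vectorspace K Q"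
   and b: "\<And>x. x \<in> carrier Q \<Longrightarrow> bilinear_map K V W U (b x)"
   and l: "\<And>v w. v \<in> carrier V \<Longrightarrow> w \<in> carrier W \<Longrightarrow> linear_map K Q U (\<lambda>x. b x v w)"
   and t: "t \<in> carrier (tensor K V W)"
  shows "linear_map K Q U (\<lambda>x. tensor_lift K U (b x) t)"
proof -
  interpret U: vectorspace K U by fact
  interpret Q: vectorspace K Q by fact
  have L1: "linear_map K (tensor K V W) U (tensor_lift K U (b x))" if "x \<in> carrier Q" for x
    by (rule tensor_lift_universal(1)[OF V W U b[OF that]])
  have L2: "tensor_lift K U (b x) (pure_tensor K V W v w) = b x v w"
    if "x \<in> carrier Q" "v \<in> carrier V" "w \<in> carrier W" for x v w
    by (rule tensor_lift_universal(2)[OF V W U b[OF that(1)] that(2,3)])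
  show ?thesis
  proof (rule linear_mapI[OF Q U])
    show "tensor_lift K U (b x) t \<in> carrier U" if "x \<in> carrier Q" for x
      by (rule linear_mapD(1)[OF L1[OF that] t])
    show "tensor_lift K U (b (x \<oplus>\<^bsub>Q\<^esub> y)) t = tensor_lift K U (b x) t \<oplus>\<^bsub>U\<^esub> tensor_lift K U (b y) t"
      if x: "x \<in> carrier Q" and y: "y \<in> carrier Q" for x y
    proof (rule tensor_ext[OF V W _ _ _ t])
      have xy: "x \<oplus>\<^bsub>Q\<^esub> y \<in> carrier Q" using x y by simp
      show "linear_map K (tensor K V W) U (tensor_lift K U (b (x \<oplus>\<^bsub>Q\<^esub> y)))" by (rule L1[OF xy])
      interpret x: linear_map K "tensor K V W" U "tensor_lift K U (b x)" by (rule L1[OF x])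
      interpret y: linear_map K "tensor K V W" U "tensor_lift K U (b y)" by (rule L1[OF y])
      show "linear_map K (tensor K V W) U (\<lambda>t. tensor_lift K U (b x) t \<oplus>\<^bsub>U\<^esub> tensor_lift K U (b y) t)"
        by (rule linear_mapI[OF tensor_vectorspace[OF V W] U]) (auto simp: U.a_ac U.smult_r_distr)
      fix v w assume vw: "v \<in> carrier V" "w \<in> carrier W"
      interpret l: linear_map K Q U "\<lambda>x. b x v w" by (rule l[OF vw])
      show "tensor_lift K U (b (x \<oplus>\<^bsub>Q\<^esub> y)) (pure_tensor K V W v w) =
         tensor_lift K U (b x) (pure_tensor K V W v w) \<oplus>\<^bsub>U\<^esub> tensor_lift K U (b y) (pure_tensor K V W v w)"
        unfolding L2[OF xy vw] L2[OF x vw] L2[OF y vw] using x y by (rule l.f_add)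
    qed
    show "tensor_lift K U (b (c \<odot>\<^bsub>Q\<^esub> x)) t = c \<odot>\<^bsub>U\<^esub> tensor_lift K U (b x) t"
      if x: "x \<in> carrier Q" and c: "c \<in> carrier K" for x c
    proof (rule tensor_ext[OF V W _ _ _ t])
      have cx: "c \<odot>\<^bsub>Q\<^esub> x \<in> carrier Q" using x c by simp
      show "linear_map K (tensor K V W) U (tensor_lift K U (b (c \<odot>\<^bsub>Q\<^esub> x)))" by (rule L1[OF cx])
      interpret x: linear_map K "tensor K V W" U "tensor_lift K U (b x)" by (rule L1[OF x])
      show "linear_map K (tensor K V W) U (\<lambda>t. c \<odot>\<^bsub>U\<^esub> tensor_lift K U (b x) t)"
        using c by (intro linear_mapI[OF tensor_vectorspace[OF V W] U]) (auto simp: U.smult_r_distr U.smult_assoc1[symmetric] U.R.m_comm)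
      fix v w assume vw: "v \<in> carrier V" "w \<in> carrier W"
      interpret l: linear_map K Q U "\<lambda>x. b x v w" by (rule l[OF vw])
      show "tensor_lift K U (b (c \<odot>\<^bsub>Q\<^esub> x)) (pure_tensor K V W v w) =
         c \<odot>\<^bsub>U\<^esub> tensor_lift K U (b x) (pure_tensor K V W v w)"
        unfolding L2[OF cx vw] L2[OF x vw] using c x by (rule l.f_smult)
    qed
  qed
qed

lemma pure_tensor3_linear:
  assumes U: "vectorspace K U" and V: "vectorspace K V" and W: "vectorspace K W"
  shows "y \<in> carrier V \<Longrightarrow> z \<in> carrier W \<Longrightarrow> linear_map K U (tensor3 K U V W) (\<lambda>x. pure_tensor3 K U V W x y z)"
  "x \<in> carrier U \<Longrightarrow> z \<in> carrier W \<Longrightarrow> linear_map K V (tensor3 K U V W) (\<lambda>y. pure_tensor3 K U V W x y z)"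
  "x \<in> carrier U \<Longrightarrow> y \<in> carrier V \<Longrightarrow> linear_map K W (tensor3 K U V W) (\<lambda>z. pure_tensor3 K U V W x y z)"
  unfolding tensor3_def pure_tensor3_def
  subgoal by (rule linear_map_comp[OF pure_tensor_linear(2)[OF U V] pure_tensor_linear(2)[OF tensor_vectorspace[OF U V] W]])
  subgoal by (rule linear_map_comp[OF pure_tensor_linear(1)[OF U V] pure_tensor_linear(2)[OF tensor_vectorspace[OF U V] W]])
  subgoal by (rule pure_tensor_linear(1)[OF tensor_vectorspace[OF U V] W linear_mapD(1)[OF pure_tensor_linear(1)[OF U V]]])
  done

lemma tensor_assoc_pure:
  assumes U: "vectorspace K U" and V: "vectorspace K V" and W: "vectorspace K W"
  shows "linear_map K (tensor K U (tensor K V W)) (tensor3 K U V W) (tensor_assoc K U V W)"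
   and "x \<in> carrier U \<Longrightarrow> y \<in> carrier V \<Longrightarrow> z \<in> carrier W \<Longrightarrow>
     tensor_assoc K U V W (pure_tensor K U (tensor K V W) x (pure_tensor K V W y z)) = pure_tensor3 K U V W x y z"
proof -
  have T: "vectorspace K (tensor3 K U V W)" unfolding tensor3_def by (intro tensor_vectorspace U V W)
  have b: "bilinear_map K V W (tensor3 K U V W) (\<lambda>y z. pure_tensor3 K U V W x y z)" if "x \<in> carrier U" for x
    using pure_tensor3_linear[OF U V W] that by (auto simp: bilinear_map_def)
  note L = tensor_lift_universal[OF V W T b]
  have bb: "bilinear_map K U (tensor K V W) (tensor3 K U V W) (\<lambda>x. tensor_lift K (tensor3 K U V W) (\<lambda>y z. pure_tensor3 K U V W x y z))"
    using L(1) pure_tensor3_linear[OF U V W] by (auto simp: bilinear_map_def intro!: tensor_lift_linear_param[OF V W T U b])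
  note LL = tensor_lift_universal[OF U tensor_vectorspace[OF V W] T bb]
  show "linear_map K (tensor K U (tensor K V W)) (tensor3 K U V W) (tensor_assoc K U V W)"
    using LL(1) by (simp add: tensor_assoc_def)
  show "x \<in> carrier U \<Longrightarrow> y \<in> carrier V \<Longrightarrow> z \<in> carrier W \<Longrightarrow>
     tensor_assoc K U V W (pure_tensor K U (tensor K V W) x (pure_tensor K V W y z)) = pure_tensor3 K U V W x y z"
    by (simp add: tensor_assoc_def LL(2) L(2) linear_mapD(1)[OF pure_tensor_linear(1)[OF V W]])
qed

lemma tensor_cycle_pure:
  assumes V: "vectorspace K V"
  shows "linear_map K (tensor3 K V V V) (tensor3 K V V V) (tensor_cycle K V)"
   and "x \<in> carrier V \<Longrightarrow> y \<in> carrier V \<Longrightarrow> z \<in> carrier V \<Longrightarrow>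
     tensor_cycle K V (pure_tensor3 K V V V x y z) = pure_tensor3 K V V V y z x"
proof -
  have T: "vectorspace K (tensor3 K V V V)" unfolding tensor3_def by (intro tensor_vectorspace V)
  have b: "bilinear_map K V V (tensor3 K V V V) (\<lambda>x y. pure_tensor3 K V V V y z x)" if "z \<in> carrier V" for z
    using pure_tensor3_linear[OF V V V] that by (auto simp: bilinear_map_def)
  note L = tensor_lift_universal[OF V V T b]
  have bb: "bilinear_map K (tensor K V V) V (tensor3 K V V V) (\<lambda>w z. tensor_lift K (tensor3 K V V V) (\<lambda>x y. pure_tensor3 K V V V y z x) w)"
    using L(1) pure_tensor3_linear[OF V V V] by (auto simp: bilinear_map_def intro!: tensor_lift_linear_param[OF V V T V b])
  note LL = tensor_lift_universal[OF tensor_vectorspace[OF V V] V T bb]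
  show "linear_map K (tensor3 K V V V) (tensor3 K V V V) (tensor_cycle K V)"
    using LL(1) by (simp add: tensor_cycle_def tensor3_def)
  show "x \<in> carrier V \<Longrightarrow> y \<in> carrier V \<Longrightarrow> z \<in> carrier V \<Longrightarrow>
     tensor_cycle K V (pure_tensor3 K V V V x y z) = pure_tensor3 K V V V y z x"
    using LL(2) L(2) linear_mapD(1)[OF pure_tensor_linear(1)[OF V V]]
    by (simp add: tensor_cycle_def) (simp add: pure_tensor3_def)
qed

end

theory Submission
  imports Defs
begin

text \<open>
  Since \<open>\<beta>\<close> commutes with \<open>\<alpha>\<close>, each term of a coalgebra axiom in \<open>L \<otimes> L \<otimes> L\<close> for the twisted
  maps at \<open>x\<close> equals the corresponding term for the original maps at \<open>\<beta>\<^sup>2 x\<close>. Likewise, each term of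
  a comodule axiom in \<open>L \<otimes> L \<otimes> M\<close> for the twisted maps at \<open>m\<close> is the image under \<open>\<beta> \<otimes> \<beta> \<otimes> Id\<close> of
  the corresponding term for the original maps at \<open>\<beta>\<^sub>M\<^sup>2 m\<close>, and \<open>\<beta> \<otimes> \<beta> \<otimes> Id\<close> commutes with
  \<open>\<tau> \<otimes> Id\<close>. The remaining axioms follow from the intertwining relations alone.
\<close>

section \<open>Linear maps, functoriality and naturality of tensor products\<close>

lemma linear_map_id:
  assumes "vectorspace K V"
  shows "linear_map K V V id"
proof -
  interpret vectorspace K V by fact
  show ?thesis by (rule linear_mapI) (use assms in auto)
qed

lemma linear_map_add:
  assumes "linear_map K V W f" "x \<in> carrier V" "y \<in> carrier V"
  shows "f (x \<oplus>\<^bsub>V\<^esub> y) = f x \<oplus>\<^bsub>W\<^esub> f y"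
proof -
  interpret linear_map K V W f by fact
  show ?thesis using assms by simp
qed

lemma linear_map_diff:
  assumes "linear_map K V W f" "x \<in> carrier V" "y \<in> carrier V"
  shows "f (x \<ominus>\<^bsub>V\<^esub> y) = f x \<ominus>\<^bsub>W\<^esub> f y"
proof -
  interpret linear_map K V W f by fact
  show ?thesis using assms by (simp add: a_minus_def f_neg)
qed

lemma vectorspace_minus_closed:
  assumes "vectorspace K V" "x \<in> carrier V" "y \<in> carrier V"
  shows "x \<ominus>\<^bsub>V\<^esub> y \<in> carrier V"
proof -
  interpret vectorspace K V by fact
  show ?thesis using assms by (simp add: a_minus_def)
qed

text \<open>Functoriality of the tensor product: both sides are linear and agree on pure tensors.
  The factorisations of \<open>h\<close> and \<open>k\<close> are required only on the carriers,
  because relations such as \<open>\<alpha> (\<beta> x) = \<beta> (\<alpha> x)\<close> are available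
  only there. The same map can thus be split in several ways without rewriting its term.\<close>

lemma tensor_map_eq_comp:
  assumes f: "linear_map K A V f" and g: "linear_map K B W g"
    and f': "linear_map K V V' f'" and g': "linear_map K W W' g'"
    and h: "\<And>x. x \<in> carrier A \<Longrightarrow> h x = f' (f x)"
    and k: "\<And>y. y \<in> carrier B \<Longrightarrow> k y = g' (g y)"
    and t: "t \<in> carrier (tensor K A B)"
  shows "tensor_map K V' W' h k t = tensor_map K V' W' f' g' (tensor_map K V W f g t)"
proof -
  interpret A: vectorspace K A by (rule linear_mapD(2)[OF f])
  interpret B: vectorspace K B by (rule linear_mapD(2)[OF g])
  interpret f: linear_map K A V f by fact
  interpret g: linear_map K B W g by fact
  interpret f': linear_map K V V' f' by fact
  interpret g': linear_map K W W' g' by fact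
  have h_lin: "linear_map K A V' h"
    by (rule linear_mapI[OF linear_mapD(2)[OF f] linear_mapD(3)[OF f']]) (auto simp: h)
  have k_lin: "linear_map K B W' k"
    by (rule linear_mapI[OF linear_mapD(2)[OF g] linear_mapD(3)[OF g']]) (auto simp: k)
  show ?thesis
    by (rule tensor_ext[OF linear_mapD(2)[OF f] linear_mapD(2)[OF g] tensor_map_pure(1)[OF h_lin k_lin]
          linear_map_comp[OF tensor_map_pure(1)[OF f g] tensor_map_pure(1)[OF f' g']] _ t])
      (simp add: tensor_map_pure(2)[OF h_lin k_lin] tensor_map_pure(2)[OF f g]
        tensor_map_pure(2)[OF f' g'] h k)
qed

text \<open>Both composites are linear and send x \<otimes> y to g y \<otimes> f x.\<close>

lemma tensor_swap_natural:
  assumes f: "linear_map K A V f" and g: "linear_map K B W g" and t: "t \<in> carrier (tensor K A B)"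
  shows "tensor_swap K V W (tensor_map K V W f g t) = tensor_map K W V g f (tensor_swap K A B t)"
  by (rule tensor_ext[OF linear_mapD(2)[OF f] linear_mapD(2)[OF g]
        linear_map_comp[OF tensor_map_pure(1)[OF f g] tensor_swap_pure(1)[OF linear_mapD(3)[OF f] linear_mapD(3)[OF g]]]
        linear_map_comp[OF tensor_swap_pure(1)[OF linear_mapD(2)[OF f] linear_mapD(2)[OF g]] tensor_map_pure(1)[OF g f]]
        _ t])
    (simp add: tensor_map_pure(2)[OF f g] tensor_map_pure(2)[OF g f] linear_mapD(1)[OF f] linear_mapD(1)[OF g]
      tensor_swap_pure(2)[OF linear_mapD(3)[OF f] linear_mapD(3)[OF g]]
      tensor_swap_pure(2)[OF linear_mapD(2)[OF f] linear_mapD(2)[OF g]])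

text \<open>Both composites send x \<otimes> (y \<otimes> z) to (f x \<otimes> g y) \<otimes> h z,
  and such elements determine a linear map. The lemma is what turns \<beta> \<otimes> (\<beta>
  \<otimes> Id) into (\<beta> \<otimes> \<beta>) \<otimes> Id in the comodule axioms.\<close>

lemma tensor_assoc_natural:
  assumes f: "linear_map K A U f" and g: "linear_map K B V g" and h: "linear_map K C W h"
    and t: "t \<in> carrier (tensor K A (tensor K B C))"
  shows "tensor_assoc K U V W (tensor_map K U (tensor K V W) f (tensor_map K V W g h) t) =
    tensor_map K (tensor K U V) W (tensor_map K U V f g) h (tensor_assoc K A B C t)"
    (is "?l t = ?r t")
proof -
  note A = linear_mapD(2)[OF f] and B = linear_mapD(2)[OF g] and C = linear_mapD(2)[OF h]
  note U = linear_mapD(3)[OF f] and V = linear_mapD(3)[OF g] and W = linear_mapD(3)[OF h]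
  note fg = tensor_map_pure[OF f g] and gh = tensor_map_pure[OF g h]
  note l = tensor_map_pure[OF f gh(1)] and r = tensor_map_pure[OF fg(1) h]
  note aA = tensor_assoc_pure[OF A B C] and aU = tensor_assoc_pure[OF U V W]
  have pBC: "pure_tensor K B C y z \<in> carrier (tensor K B C)" if "y \<in> carrier B" "z \<in> carrier C" for y z
    by (rule linear_mapD(1)[OF pure_tensor_linear(1)[OF B C that(1)] that(2)])
  have pAB: "pure_tensor K A B x y \<in> carrier (tensor K A B)" if "x \<in> carrier A" "y \<in> carrier B" for x y
    by (rule linear_mapD(1)[OF pure_tensor_linear(1)[OF A B that(1)] that(2)])
  have L: "linear_map K (tensor K A (tensor K B C)) (tensor3 K U V W) ?l"
    by (rule linear_map_comp[OF l(1) aU(1)])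
  have R: "linear_map K (tensor K A (tensor K B C)) (tensor3 K U V W) ?r"
    by (rule linear_map_comp[OF aA(1)]) (use r(1) in \<open>simp add: tensor3_def\<close>)
  \<comment> \<open>Extensionality is needed twice: the right factor \<open>s\<close> of a pure
    tensor is itself an arbitrary element of a tensor product. For fixed \<open>x\<close>, both
    sides are linear in \<open>s\<close>, so \<open>s\<close> may be taken pure as well.\<close>
  have "?l (pure_tensor K A (tensor K B C) x s) = ?r (pure_tensor K A (tensor K B C) x s)"
    if x: "x \<in> carrier A" and s: "s \<in> carrier (tensor K B C)" for x s
  proof -
    note px = pure_tensor_linear(1)[OF A tensor_vectorspace[OF B C] x]
    show ?thesis
    proof (rule tensor_ext[OF B C linear_map_comp[OF px L] linear_map_comp[OF px R] _ s])
      fix y z assume yz: "y \<in> carrier B" "z \<in> carrier C"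
      show "?l (pure_tensor K A (tensor K B C) x (pure_tensor K B C y z)) =
        ?r (pure_tensor K A (tensor K B C) x (pure_tensor K B C y z))"
        using x yz by (simp add: l(2) gh(2) aU(2) aA(2) pBC linear_mapD(1)[OF f] linear_mapD(1)[OF g]
            linear_mapD(1)[OF h] pure_tensor3_def r(2) fg(2) pAB)
    qed
  qed
  then show ?thesis by (rule tensor_ext[OF A tensor_vectorspace[OF B C] L R _ t])
qed

section \<open>The twisted coalgebra\<close>

context post_Hom_Lie_coalgebra_endomorphism
begin

lemma vectorspace_L: "vectorspace K L"
  by (rule linear_mapD(2)[OF linear_alpha])

text \<open>On the carrier, \<beta> \<circ> \<alpha> is \<alpha> \<circ> \<beta>, so both tensor
  factors start with \<beta> and functoriality splits off \<beta> \<otimes> \<beta>.\<close>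

lemma twisted_left:
  assumes "linear_map K L (tensor K L L) \<phi>" "t \<in> carrier (tensor K L L)"
  shows "tensor_map K (tensor K L L) L (\<phi> \<circ> \<beta>) (\<beta> \<circ> \<alpha>) t =
    tensor_map K (tensor K L L) L \<phi> \<alpha> (tensor_map K L L \<beta> \<beta> t)"
  by (rule tensor_map_eq_comp[OF linear_beta linear_beta assms(1) linear_alpha _ _ assms(2)])
    (simp_all add: alpha_beta)

text \<open>The same splitting with the two tensor factors exchanged.\<close>

lemma twisted_right:
  assumes "linear_map K L (tensor K L L) \<phi>" "t \<in> carrier (tensor K L L)"
  shows "tensor_map K L (tensor K L L) (\<beta> \<circ> \<alpha>) (\<phi> \<circ> \<beta>) t =
    tensor_map K L (tensor K L L) \<alpha> \<phi> (tensor_map K L L \<beta> \<beta> t)"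
  by (rule tensor_map_eq_comp[OF linear_beta linear_beta linear_alpha assms(1) _ _ assms(2)])
    (simp_all add: alpha_beta)

lemma twisted_coalgebra: "post_Hom_Lie_coalgebra K L (\<gamma> \<circ> \<beta>) (\<Delta> \<circ> \<beta>) (\<beta> \<circ> \<alpha>)"
proof -
  have \<beta>: "\<beta> x \<in> carrier L" and \<gamma>: "\<gamma> x \<in> carrier (tensor K L L)"
    and \<Delta>: "\<Delta> x \<in> carrier (tensor K L L)" and \<alpha>: "\<alpha> x \<in> carrier L" if "x \<in> carrier L" for x
    using that linear_mapD(1)[OF linear_beta] linear_mapD(1)[OF linear_gamma]
      linear_mapD(1)[OF linear_Delta] linear_mapD(1)[OF linear_alpha] by auto
  \<comment> \<open>As rewrite rules, the first four facts expose \<beta> \<otimes> \<beta>, and the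
    reversed intertwining relations absorb it into the argument: a value at \<open>\<beta> x\<close>
    becomes one at \<open>\<beta> (\<beta> x)\<close>.\<close>
  note twisted = twisted_left[OF linear_gamma] twisted_left[OF linear_Delta]
    twisted_right[OF linear_gamma] twisted_right[OF linear_Delta]
    gamma_beta[symmetric] Delta_beta[symmetric]
  show ?thesis
  proof (rule post_Hom_Lie_coalgebra.intro[OF field_of_char_0_axioms],
      rule post_Hom_Lie_coalgebra_axioms.intro, goal_cases)
    case 1
    show ?case using linear_map_comp[OF linear_beta linear_gamma] by (simp add: comp_def)
  next
    case 2
    show ?case using linear_map_comp[OF linear_beta linear_Delta] by (simp add: comp_def)
  next
    case 3
    show ?case using linear_map_comp[OF linear_alpha linear_beta] by (simp add: comp_def)
  next
    case (4 x)
    then show ?case using gamma_antisym[OF \<beta>] by simp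
  next
    case (5 x)
    \<comment> \<open>Here \<alpha> \<otimes> \<alpha> is applied first, so that multiplicativity of
      \<gamma> under \<alpha> absorbs it; \<beta> \<otimes> \<beta> is absorbed afterwards.\<close>
    have "tensor_map K L L (\<beta> \<circ> \<alpha>) (\<beta> \<circ> \<alpha>) (\<gamma> (\<beta> x)) = tensor_map K L L \<beta> \<beta> (\<gamma> (\<alpha> (\<beta> x)))"
      using 5 \<beta> \<gamma> by (simp add: gamma_alpha
          tensor_map_eq_comp[OF linear_alpha linear_alpha linear_beta linear_beta])
    with 5 show ?case by (simp add: \<alpha> \<beta> alpha_beta gamma_beta)
  next
    case (6 x w)
    \<comment> \<open>After rewriting, \<open>w\<close> is literally the original element at
      \<open>\<beta> (\<beta> x)\<close>, so its cyclic sum is the one in the original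
      identity.\<close>
    then show ?case using Hom_Jacobi[of "\<beta> (\<beta> x)" w] by (simp add: \<beta> \<gamma> twisted)
  next
    case (7 x)
    then show ?case using Delta_gamma[of "\<beta> (\<beta> x)"] by (simp add: \<beta> \<gamma> \<Delta> twisted)
  next
    case (8 x)
    then show ?case using Delta_coassociator[of "\<beta> (\<beta> x)"] by (simp add: \<beta> \<gamma> \<Delta> twisted)
  qed
qed

end

section \<open>The twisted comodule\<close>

theorem theorem5p10:
  fixes K :: "('k, 'r) ring_scheme"
    and L :: "('k, 'l, 's) module_scheme"
    and M :: "('k, 'm, 't) module_scheme"
  assumes "post_Hom_Lie_comodule K L \<gamma> \<Delta> \<alpha> M D B \<alpha>\<^sub>M"
    and "post_Hom_Lie_coalgebra_endomorphism K L \<gamma> \<Delta> \<alpha> \<beta>"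
    and "linear_map K M M \<beta>\<^sub>M"
    and "\<And>m. m \<in> carrier M \<Longrightarrow> \<alpha>\<^sub>M (\<beta>\<^sub>M m) = \<beta>\<^sub>M (\<alpha>\<^sub>M m)"
    and "\<And>m. m \<in> carrier M \<Longrightarrow> D (\<beta>\<^sub>M m) = tensor_map K L M \<beta> \<beta>\<^sub>M (D m)"
    and "\<And>m. m \<in> carrier M \<Longrightarrow> B (\<beta>\<^sub>M m) = tensor_map K L M \<beta> \<beta>\<^sub>M (B m)"
  shows "post_Hom_Lie_comodule K L (\<gamma> \<circ> \<beta>) (\<Delta> \<circ> \<beta>) (\<beta> \<circ> \<alpha>)
           M (tensor_map K L M \<beta> id \<circ> D \<circ> \<beta>\<^sub>M) (tensor_map K L M \<beta> id \<circ> B \<circ> \<beta>\<^sub>M) (\<alpha>\<^sub>M \<circ> \<beta>\<^sub>M)"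
proof -
  interpret post_Hom_Lie_comodule K L \<gamma> \<Delta> \<alpha> M D B \<alpha>\<^sub>M by fact
  interpret E: post_Hom_Lie_coalgebra_endomorphism K L \<gamma> \<Delta> \<alpha> \<beta> by fact
  note \<beta> = E.linear_beta and \<beta>\<^sub>M = assms(3)
  note L = E.vectorspace_L and M = linear_mapD(2)[OF \<beta>\<^sub>M]
  note LL = tensor_vectorspace[OF L L]
  have LLM: "vectorspace K (tensor3 K L L M)" unfolding tensor3_def by (rule tensor_vectorspace[OF LL M])
  note id_M = linear_map_id[OF M]
  note \<beta>\<beta> = tensor_map_pure(1)[OF \<beta> \<beta>] and \<beta>_id = tensor_map_pure(1)[OF \<beta> id_M]
  note swap = tensor_swap_pure(1)[OF L L]
  let ?D = "tensor_map K L M \<beta> id \<circ> D \<circ> \<beta>\<^sub>M" and ?B = "tensor_map K L M \<beta> id \<circ> B \<circ> \<beta>\<^sub>M"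
  let ?\<Phi> = "tensor_map K (tensor K L L) M (tensor_map K L L \<beta> \<beta>) id"
  let ?\<tau> = "tensor_map K (tensor K L L) M (tensor_swap K L L) id"
  have \<Phi>: "linear_map K (tensor3 K L L M) (tensor3 K L L M) ?\<Phi>"
    and \<tau>: "linear_map K (tensor3 K L L M) (tensor3 K L L M) ?\<tau>"
    using tensor_map_pure(1)[OF \<beta>\<beta> id_M] tensor_map_pure(1)[OF swap id_M] by (simp_all add: tensor3_def)
  \<comment> \<open>Both sides are a single map on L \<otimes> L tensored with the identity of M.
    Naturality of the swap leaves \<beta> \<otimes> \<beta> unchanged because its two factors
    coincide.\<close>
  have \<tau>_\<Phi>: "?\<tau> (?\<Phi> t) = ?\<Phi> (?\<tau> t)" if t: "t \<in> carrier (tensor3 K L L M)" for t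
  proof -
    have t': "t \<in> carrier (tensor K (tensor K L L) M)" using t by (simp add: tensor3_def)
    have "?\<tau> (?\<Phi> t) = tensor_map K (tensor K L L) M (\<lambda>s. tensor_swap K L L (tensor_map K L L \<beta> \<beta> s)) id t"
      by (rule tensor_map_eq_comp[OF \<beta>\<beta> id_M swap id_M _ _ t', symmetric]) auto
    also have "\<dots> = ?\<Phi> (?\<tau> t)"
      by (rule tensor_map_eq_comp[OF swap id_M \<beta>\<beta> id_M _ _ t']) (auto simp: tensor_swap_natural[OF \<beta> \<beta>])
    finally show ?thesis .
  qed
  have \<beta>\<^sub>M_closed: "\<beta>\<^sub>M m \<in> carrier M" and \<alpha>\<^sub>M_closed: "\<alpha>\<^sub>M m \<in> carrier M"
    and D_closed: "D m \<in> carrier (tensor K L M)" and B_closed: "B m \<in> carrier (tensor K L M)"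
    if "m \<in> carrier M" for m
    using that linear_mapD(1)[OF \<beta>\<^sub>M] linear_mapD(1)[OF linear_mu]
      linear_mapD(1)[OF linear_D] linear_mapD(1)[OF linear_B] by auto
  have twisted_linear: "linear_map K M (tensor K L M) (tensor_map K L M \<beta> id \<circ> X \<circ> \<beta>\<^sub>M)"
    if "linear_map K M (tensor K L M) X" for X
    using linear_map_comp[OF linear_map_comp[OF \<beta>\<^sub>M that] \<beta>_id] by (simp add: comp_def)
  \<comment> \<open>Both sides reduce to \<beta>\<beta>\<alpha> \<otimes>
    \<open>\<alpha>\<^sub>M \<beta>\<^sub>M\<close> applied to \<open>X (\<beta>\<^sub>M m)\<close>.
    The map \<open>X\<close> is kept general so that one argument serves both \<open>D\<close> and
    \<open>B\<close>.\<close>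
  have twisted_mu: "tensor_map K L M \<beta> id (X (\<beta>\<^sub>M (\<alpha>\<^sub>M (\<beta>\<^sub>M m)))) =
      tensor_map K L M (\<beta> \<circ> \<alpha>) (\<alpha>\<^sub>M \<circ> \<beta>\<^sub>M) (tensor_map K L M \<beta> id (X (\<beta>\<^sub>M m)))"
    if X: "linear_map K M (tensor K L M) X"
      and X\<beta>: "\<And>m. m \<in> carrier M \<Longrightarrow> X (\<beta>\<^sub>M m) = tensor_map K L M \<beta> \<beta>\<^sub>M (X m)"
      and X\<alpha>: "\<And>m. m \<in> carrier M \<Longrightarrow> X (\<alpha>\<^sub>M m) = tensor_map K L M \<alpha> \<alpha>\<^sub>M (X m)"
      and m: "m \<in> carrier M" for X m
  proof -
    let ?t = "X (\<beta>\<^sub>M m)"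
    have t: "?t \<in> carrier (tensor K L M)" by (rule linear_mapD(1)[OF X \<beta>\<^sub>M_closed[OF m]])
    note \<beta>\<alpha> = linear_map_comp[OF linear_alpha \<beta>] and \<alpha>\<beta>\<^sub>M = linear_map_comp[OF \<beta>\<^sub>M linear_mu]
    have "tensor_map K L M \<beta> id (X (\<beta>\<^sub>M (\<alpha>\<^sub>M (\<beta>\<^sub>M m)))) =
        tensor_map K L M \<beta> id (tensor_map K L M \<beta> \<beta>\<^sub>M (tensor_map K L M \<alpha> \<alpha>\<^sub>M ?t))"
      using m by (simp add: X\<beta>[of "\<alpha>\<^sub>M (\<beta>\<^sub>M m)"] X\<alpha> \<beta>\<^sub>M_closed \<alpha>\<^sub>M_closed)
    also have "\<dots> = tensor_map K L M \<beta> id (tensor_map K L M (\<lambda>x. \<beta> (\<alpha> x)) (\<lambda>x. \<alpha>\<^sub>M (\<beta>\<^sub>M x)) ?t)"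
      by (rule arg_cong[of _ _ "tensor_map K L M \<beta> id"],
          rule tensor_map_eq_comp[OF linear_alpha linear_mu \<beta> \<beta>\<^sub>M _ _ t, symmetric])
        (auto simp: assms(4))
    also have "\<dots> = tensor_map K L M (\<lambda>x. \<beta> (\<beta> (\<alpha> x))) (\<lambda>x. \<alpha>\<^sub>M (\<beta>\<^sub>M x)) ?t"
      by (rule tensor_map_eq_comp[OF \<beta>\<alpha> \<alpha>\<beta>\<^sub>M \<beta> id_M _ _ t, symmetric]) auto
    also have "\<dots> = tensor_map K L M (\<beta> \<circ> \<alpha>) (\<alpha>\<^sub>M \<circ> \<beta>\<^sub>M) (tensor_map K L M \<beta> id ?t)"
      unfolding comp_def
      by (rule tensor_map_eq_comp[OF \<beta> id_M \<beta>\<alpha> \<alpha>\<beta>\<^sub>M _ _ t]) (auto simp: E.alpha_beta)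
    finally show ?thesis .
  qed
  \<comment> \<open>The left factor of the composite is \<phi>\<beta>\<beta>. One \<beta> leaves
    through \<phi> as \<beta> \<otimes> \<beta> and yields \<open>?\<Phi>\<close>; the other joins
    \<open>\<beta>\<^sub>M\<close> from the right factor to form \<beta> \<otimes>
    \<open>\<beta>\<^sub>M\<close>, which \<open>X\<close> absorbs.\<close>
  have twisted_left: "tensor_map K (tensor K L L) M (\<phi> \<circ> \<beta>) (\<alpha>\<^sub>M \<circ> \<beta>\<^sub>M) (tensor_map K L M \<beta> id (X (\<beta>\<^sub>M m))) =
      ?\<Phi> (tensor_map K (tensor K L L) M \<phi> \<alpha>\<^sub>M (X (\<beta>\<^sub>M (\<beta>\<^sub>M m))))"
    if \<phi>: "linear_map K L (tensor K L L) \<phi>"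
      and \<phi>\<beta>: "\<And>x. x \<in> carrier L \<Longrightarrow> \<phi> (\<beta> x) = tensor_map K L L \<beta> \<beta> (\<phi> x)"
      and X: "linear_map K M (tensor K L M) X"
      and X\<beta>: "\<And>m. m \<in> carrier M \<Longrightarrow> X (\<beta>\<^sub>M m) = tensor_map K L M \<beta> \<beta>\<^sub>M (X m)"
      and m: "m \<in> carrier M" for \<phi> X m
  proof -
    let ?t = "X (\<beta>\<^sub>M m)"
    have t: "?t \<in> carrier (tensor K L M)" by (rule linear_mapD(1)[OF X \<beta>\<^sub>M_closed[OF m]])
    note \<phi>\<beta>' = linear_map_comp[OF \<beta> \<phi>] and \<alpha>\<beta>\<^sub>M = linear_map_comp[OF \<beta>\<^sub>M linear_mu]
    have "tensor_map K (tensor K L L) M (\<phi> \<circ> \<beta>) (\<alpha>\<^sub>M \<circ> \<beta>\<^sub>M) (tensor_map K L M \<beta> id ?t) =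
        tensor_map K (tensor K L L) M (\<lambda>x. \<phi> (\<beta> (\<beta> x))) (\<lambda>x. \<alpha>\<^sub>M (\<beta>\<^sub>M x)) ?t"
      unfolding comp_def by (rule tensor_map_eq_comp[OF \<beta> id_M \<phi>\<beta>' \<alpha>\<beta>\<^sub>M _ _ t, symmetric]) auto
    also have "\<dots> = ?\<Phi> (tensor_map K (tensor K L L) M (\<lambda>x. \<phi> (\<beta> x)) (\<lambda>x. \<alpha>\<^sub>M (\<beta>\<^sub>M x)) ?t)"
      by (rule tensor_map_eq_comp[OF \<phi>\<beta>' \<alpha>\<beta>\<^sub>M \<beta>\<beta> id_M _ _ t])
        (auto simp: \<phi>\<beta>[OF linear_mapD(1)[OF \<beta>]])
    also have "tensor_map K (tensor K L L) M (\<lambda>x. \<phi> (\<beta> x)) (\<lambda>x. \<alpha>\<^sub>M (\<beta>\<^sub>M x)) ?t =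
        tensor_map K (tensor K L L) M \<phi> \<alpha>\<^sub>M (tensor_map K L M \<beta> \<beta>\<^sub>M ?t)"
      by (rule tensor_map_eq_comp[OF \<beta> \<beta>\<^sub>M \<phi> linear_mu _ _ t]) auto
    also have "tensor_map K L M \<beta> \<beta>\<^sub>M ?t = X (\<beta>\<^sub>M (\<beta>\<^sub>M m))"
      by (rule X\<beta>[OF \<beta>\<^sub>M_closed[OF m], symmetric])
    finally show ?thesis .
  qed
  \<comment> \<open>The left factor is now \<beta>\<alpha>\<beta>. Its outer \<beta> pairs with the
    \<beta> \<otimes> Id that ends the twisted coaction; its inner \<beta> pairs with the
    \<open>\<beta>\<^sub>M\<close> that begins it and is absorbed by \<open>X\<close>.\<close>
  have twisted_right: "tensor_assoc K L L M (tensor_map K L (tensor K L M) (\<beta> \<circ> \<alpha>)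
        (tensor_map K L M \<beta> id \<circ> Y \<circ> \<beta>\<^sub>M) (tensor_map K L M \<beta> id (X (\<beta>\<^sub>M m)))) =
      ?\<Phi> (tensor_assoc K L L M (tensor_map K L (tensor K L M) \<alpha> Y (X (\<beta>\<^sub>M (\<beta>\<^sub>M m)))))"
    if Y: "linear_map K M (tensor K L M) Y"
      and X: "linear_map K M (tensor K L M) X"
      and X\<beta>: "\<And>m. m \<in> carrier M \<Longrightarrow> X (\<beta>\<^sub>M m) = tensor_map K L M \<beta> \<beta>\<^sub>M (X m)"
      and m: "m \<in> carrier M" for Y X m
  proof -
    let ?t = "X (\<beta>\<^sub>M m)"
    let ?Y = "tensor_map K L M \<beta> id \<circ> Y \<circ> \<beta>\<^sub>M"
    have t: "?t \<in> carrier (tensor K L M)" by (rule linear_mapD(1)[OF X \<beta>\<^sub>M_closed[OF m]])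
    note \<beta>\<alpha> = linear_map_comp[OF linear_alpha \<beta>] and \<alpha>\<beta> = linear_map_comp[OF \<beta> linear_alpha]
      and Y\<beta> = linear_map_comp[OF \<beta>\<^sub>M Y]
    have "tensor_map K L (tensor K L M) (\<beta> \<circ> \<alpha>) ?Y (tensor_map K L M \<beta> id ?t) =
        tensor_map K L (tensor K L M) (\<lambda>x. \<beta> (\<alpha> (\<beta> x))) ?Y ?t"
      by (rule tensor_map_eq_comp[OF \<beta> id_M _ twisted_linear[OF Y] _ _ t, symmetric])
        (use \<beta>\<alpha> in \<open>auto simp: comp_def\<close>)
    also have "\<dots> = tensor_map K L (tensor K L M) \<beta> (tensor_map K L M \<beta> id)
        (tensor_map K L (tensor K L M) (\<lambda>x. \<alpha> (\<beta> x)) (\<lambda>x. Y (\<beta>\<^sub>M x)) ?t)"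
      by (rule tensor_map_eq_comp[OF \<alpha>\<beta> Y\<beta> \<beta> \<beta>_id _ _ t]) auto
    also have "tensor_map K L (tensor K L M) (\<lambda>x. \<alpha> (\<beta> x)) (\<lambda>x. Y (\<beta>\<^sub>M x)) ?t =
        tensor_map K L (tensor K L M) \<alpha> Y (tensor_map K L M \<beta> \<beta>\<^sub>M ?t)"
      by (rule tensor_map_eq_comp[OF \<beta> \<beta>\<^sub>M linear_alpha Y _ _ t]) auto
    also have "tensor_map K L M \<beta> \<beta>\<^sub>M ?t = X (\<beta>\<^sub>M (\<beta>\<^sub>M m))"
      by (rule X\<beta>[OF \<beta>\<^sub>M_closed[OF m], symmetric])
    finally have "tensor_map K L (tensor K L M) (\<beta> \<circ> \<alpha>) ?Y (tensor_map K L M \<beta> id ?t) =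
        tensor_map K L (tensor K L M) \<beta> (tensor_map K L M \<beta> id)
          (tensor_map K L (tensor K L M) \<alpha> Y (X (\<beta>\<^sub>M (\<beta>\<^sub>M m))))" .
    moreover have "tensor_map K L (tensor K L M) \<alpha> Y (X (\<beta>\<^sub>M (\<beta>\<^sub>M m))) \<in> carrier (tensor K L (tensor K L M))"
      by (intro linear_mapD(1)[OF tensor_map_pure(1)[OF linear_alpha Y]] linear_mapD(1)[OF X] \<beta>\<^sub>M_closed m)
    \<comment> \<open>Reassociation converts the outer \<beta> \<otimes> (\<beta> \<otimes> Id) into
      \<open>?\<Phi>\<close>.\<close>
    ultimately show ?thesis by (simp add: tensor_assoc_natural[OF \<beta> \<beta> id_M])
  qed
  \<comment> \<open>Moving \<open>?\<Phi>\<close> through sums, differences and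
    \<open>?\<tau>\<close> is justified only on the carrier, hence these closure facts for the
    original terms.\<close>
  have left_closed: "tensor_map K (tensor K L L) M \<phi> \<alpha>\<^sub>M t \<in> carrier (tensor3 K L L M)"
    if "linear_map K L (tensor K L L) \<phi>" "t \<in> carrier (tensor K L M)" for \<phi> t
    unfolding tensor3_def by (rule linear_mapD(1)[OF tensor_map_pure(1)[OF that(1) linear_mu] that(2)])
  have right_closed: "tensor_assoc K L L M (tensor_map K L (tensor K L M) \<alpha> Y t) \<in> carrier (tensor3 K L L M)"
    if "linear_map K M (tensor K L M) Y" "t \<in> carrier (tensor K L M)" for Y t
    by (intro linear_mapD(1)[OF tensor_assoc_pure(1)[OF L L M]]
        linear_mapD(1)[OF tensor_map_pure(1)[OF linear_alpha that(1)]] that(2))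
  note closed = \<beta>\<^sub>M_closed D_closed B_closed linear_mapD(1)[OF \<tau>] vectorspace_minus_closed[OF LLM]
    left_closed[OF linear_Delta] right_closed[OF linear_D] right_closed[OF linear_B]
  note D\<beta> = assms(5) and B\<beta> = assms(6)
  note left = twisted_left[OF linear_gamma E.gamma_beta linear_D D\<beta>]
    twisted_left[OF linear_gamma E.gamma_beta linear_B B\<beta>]
    twisted_left[OF linear_Delta E.Delta_beta linear_D D\<beta>]
    twisted_left[OF linear_Delta E.Delta_beta linear_B B\<beta>]
  note right = twisted_right[OF linear_D linear_D D\<beta>] twisted_right[OF linear_D linear_B B\<beta>]
    twisted_right[OF linear_B linear_D D\<beta>] twisted_right[OF linear_B linear_B B\<beta>]
  show ?thesis
  proof (rule post_Hom_Lie_comodule.intro[OF E.twisted_coalgebra],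
      rule post_Hom_Lie_comodule_axioms.intro, goal_cases)
    case 1
    show ?case by (rule twisted_linear[OF linear_D])
  next
    case 2
    show ?case by (rule twisted_linear[OF linear_B])
  next
    case 3
    show ?case using linear_map_comp[OF \<beta>\<^sub>M linear_mu] by (simp add: comp_def)
  next
    case (4 m)
    then show ?case using twisted_mu[OF linear_D D\<beta> D_mu] by simp
  next
    case (5 m)
    then show ?case using twisted_mu[OF linear_B B\<beta> B_mu] by simp
  next
    case (6 m)
    let ?n = "\<beta>\<^sub>M (\<beta>\<^sub>M m)"
    let ?u = "tensor_assoc K L L M (tensor_map K L (tensor K L M) \<alpha> D (D ?n))"
    have u: "?u \<in> carrier (tensor3 K L L M)" using 6 by (intro closed)
    \<comment> \<open>This is the original axiom at \<open>?n\<close> with \<open>?\<Phi>\<close>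
      applied to both sides; the twisted terms are recognised afterwards.\<close>
    have "?\<Phi> (tensor_map K (tensor K L L) M \<gamma> \<alpha>\<^sub>M (D ?n)) =
        ?\<Phi> ?u \<ominus>\<^bsub>tensor3 K L L M\<^esub> ?\<tau> (?\<Phi> ?u)"
      using 6 u by (simp add: gamma_D linear_map_diff[OF \<Phi>] \<tau>_\<Phi> closed(1,4))
    with 6 show ?case by (simp add: left right)
  next
    case (7 m)
    let ?n = "\<beta>\<^sub>M (\<beta>\<^sub>M m)"
    let ?u = "tensor_assoc K L L M (tensor_map K L (tensor K L M) \<alpha> D (B ?n))"
    let ?v = "tensor_assoc K L L M (tensor_map K L (tensor K L M) \<alpha> B (D ?n))"
    have uv: "?u \<in> carrier (tensor3 K L L M)" "?v \<in> carrier (tensor3 K L L M)"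
      using 7 by (intro closed; simp)+
    have "?\<Phi> (tensor_map K (tensor K L L) M \<Delta> \<alpha>\<^sub>M (D ?n)) =
        ?\<Phi> ?u \<ominus>\<^bsub>tensor3 K L L M\<^esub> ?\<tau> (?\<Phi> ?v)"
      using 7 uv by (simp add: Delta_D linear_map_diff[OF \<Phi>] \<tau>_\<Phi> closed(1,4))
    with 7 show ?case by (simp add: left right)
  next
    case (8 m v w)
    let ?n = "\<beta>\<^sub>M (\<beta>\<^sub>M m)"
    let ?v = "tensor_assoc K L L M (tensor_map K L (tensor K L M) \<alpha> B (B ?n))"
    let ?w = "tensor_map K (tensor K L L) M \<Delta> \<alpha>\<^sub>M (B ?n)"
    have vw: "?v \<in> carrier (tensor3 K L L M)" "?w \<in> carrier (tensor3 K L L M)"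
      using 8(1) by (intro closed; simp)+
    \<comment> \<open>The abbreviations \<open>v\<close> and \<open>w\<close> of the twisted axiom
      are the images of the original ones, so linearity of \<open>?\<Phi>\<close> transports the
      whole right-hand side.\<close>
    have "v = ?\<Phi> ?v" "w = ?\<Phi> ?w"
      using 8 by (simp_all add: left right)
    moreover have "?\<Phi> (tensor_map K (tensor K L L) M \<gamma> \<alpha>\<^sub>M (B ?n)) =
        (?\<Phi> ?v \<ominus>\<^bsub>tensor3 K L L M\<^esub> ?\<tau> (?\<Phi> ?v)) \<oplus>\<^bsub>tensor3 K L L M\<^esub>
        (?\<tau> (?\<Phi> ?w) \<ominus>\<^bsub>tensor3 K L L M\<^esub> ?\<Phi> ?w)"
      using 8(1) vw gamma_B[OF _ refl refl, of ?n]
      by (simp add: linear_map_add[OF \<Phi>] linear_map_diff[OF \<Phi>] \<tau>_\<Phi> closed(1,4,5))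
    ultimately show ?case using 8(1) by (simp add: left)
  qed
qed

end
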